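(* For any fixed positive integer $r$, the following problem can be solved in polynomial time: given $n\geq r$, a bipartite graph $H\subseteq K_{r,n-r}$ on $[n]$, and arbitrary functions $f_i:\{0,1,\dots,d_i(H)\}\to\mathbb{Z}$ for $i=1,\dots,n$, find a subgraph $G\subseteq H$ on $[n]$ minimizing $\sum_{i=1}^n f_i(d_i(G))$.
   Context: All graphs are finite and simple, and $[n]:=\{1,\dots,n\}$. For a graph $G=([n],F)$ and $i\in[n]$, $d_i(G):=|\{e\in F: i\in e\}|$ is the degree of vertex $i$ in $G$. A subgraph $G\subseteq H$ on $[n]$ of a graph $H=([n],E)$ is a graph $G=([n],F)$ with $F\subseteq E$ (an arbitrary subset of the edges, on the full vertex set). $K_{r,n-r}$ is the complete bipartite graph with sides $\{1,\dots,r\}$ and $\{r+1,\dots,n\}$; thus $H\subseteq K_{r,n-r}$ means that every edge of $H$ joins a vertex of $\{1,\dots,r\}$ to a vertex of $\{r+1,\dots,n\}$. Each function $f_i$ in the input is given by the explicit list of its values (integers in binary), and polynomial time means polynomial in the total bit size of the input, where the degree of the polynomial may depend on the constant $r$. *)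

theory Defs
  imports
    "HOL-Library.Log_Nat"
    "HOL-Computational_Algebra.Polynomial"
begin

text \<open>
  \<^bold>\<open>Machine model.\<close>  Polynomial time is measured on the random access machine of Cook--Reckhow and
  Aho--Hopcroft--Ullman under the logarithmic cost criterion, which is polynomially equivalent to
  the Turing machine.  The machine has registers \<open>0, 1, 2, \<dots>\<close> holding arbitrary integers, initially
  all \<open>0\<close>, a read-only input tape and a write-only output tape, both consisting of integers.
  Arithmetic is restricted to addition and subtraction.  Programs are structured (sequence,
  conditional, loop) instead of using jumps; translating them into jumps changes the cost by a
  constant factor only.
\<close>

text \<open>A sign bit followed by the binary digits of the absolute value.\<close>

definition bit_size :: "int \<Rightarrow> nat" where
  "bit_size z = 1 + floorlog 2 (nat \<bar>z\<bar>)"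

definition total_bit_size :: "int list \<Rightarrow> nat" where
  "total_bit_size xs = (\<Sum>z\<leftarrow>xs. bit_size z)"

datatype prog =
    Skip
  | Const nat int      \<comment> \<open>\<open>R[d] := k\<close>\<close>
  | Copy nat nat       \<comment> \<open>\<open>R[d] := R[a]\<close>\<close>
  | Add nat nat nat    \<comment> \<open>\<open>R[d] := R[a] + R[b]\<close>\<close>
  | Sub nat nat nat    \<comment> \<open>\<open>R[d] := R[a] - R[b]\<close>\<close>
  | Load nat nat       \<comment> \<open>\<open>R[d] := R[R[a]]\<close>\<close>
  | Store nat nat      \<comment> \<open>\<open>R[R[d]] := R[a]\<close>\<close>
  | Read nat           \<comment> \<open>\<open>R[d] :=\<close> next input integer\<close>
  | Write nat          \<comment> \<open>append \<open>R[a]\<close> to the output\<close>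
  | Seq prog prog
  | IfPos nat prog prog  \<comment> \<open>branch on \<open>R[a] > 0\<close>\<close>
  | WhilePos nat prog    \<comment> \<open>loop while \<open>R[a] > 0\<close>\<close>

text \<open>Register contents, unread input, output written so far.\<close>

type_synonym config = "(nat \<Rightarrow> int) \<times> int list \<times> int list"

text \<open>Cost of accessing the register with address \<open>a\<close>: the size of the address and of the content.\<close>

definition access_cost :: "(nat \<Rightarrow> int) \<Rightarrow> nat \<Rightarrow> nat" where
  "access_cost R a = bit_size (int a) + bit_size (R a)"

text \<open>
  \<open>exec c s t s'\<close>: started in \<open>s\<close>, the program \<open>c\<close> halts in \<open>s'\<close> after time \<open>t\<close>.  The machine is
  stuck (no result) on indirect addressing with a negative address and on reading past the end of
  the input.
\<close>

inductive exec :: "prog \<Rightarrow> config \<Rightarrow> nat \<Rightarrow> config \<Rightarrow> bool" where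
  Skip: "exec Skip s 1 s"
| Const: "exec (Const d k) (R, xs, ys) (bit_size (int d) + bit_size k) (R(d := k), xs, ys)"
| Copy: "exec (Copy d a) (R, xs, ys) (bit_size (int d) + access_cost R a) (R(d := R a), xs, ys)"
| Add: "exec (Add d a b) (R, xs, ys) (bit_size (int d) + access_cost R a + access_cost R b)
          (R(d := R a + R b), xs, ys)"
| Sub: "exec (Sub d a b) (R, xs, ys) (bit_size (int d) + access_cost R a + access_cost R b)
          (R(d := R a - R b), xs, ys)"
| Load: "R a \<ge> 0 \<Longrightarrow>
    exec (Load d a) (R, xs, ys) (bit_size (int d) + access_cost R a + bit_size (R (nat (R a))))
      (R(d := R (nat (R a))), xs, ys)"
| Store: "R d \<ge> 0 \<Longrightarrow>
    exec (Store d a) (R, xs, ys) (access_cost R d + access_cost R a)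
      (R(nat (R d) := R a), xs, ys)"
| Read: "exec (Read d) (R, x # xs, ys) (bit_size (int d) + bit_size x) (R(d := x), xs, ys)"
| Write: "exec (Write a) (R, xs, ys) (access_cost R a) (R, xs, ys @ [R a])"
| Seq: "exec c1 s t1 s' \<Longrightarrow> exec c2 s' t2 s'' \<Longrightarrow> exec (Seq c1 c2) s (t1 + t2) s''"
| IfTrue: "R a > 0 \<Longrightarrow> exec c1 (R, xs, ys) t s' \<Longrightarrow>
    exec (IfPos a c1 c2) (R, xs, ys) (access_cost R a + t) s'"
| IfFalse: "R a \<le> 0 \<Longrightarrow> exec c2 (R, xs, ys) t s' \<Longrightarrow>
    exec (IfPos a c1 c2) (R, xs, ys) (access_cost R a + t) s'"
| WhileFalse: "R a \<le> 0 \<Longrightarrow>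
    exec (WhilePos a c) (R, xs, ys) (access_cost R a) (R, xs, ys)"
| WhileTrue: "R a > 0 \<Longrightarrow> exec c (R, xs, ys) t1 s' \<Longrightarrow> exec (WhilePos a c) s' t2 s'' \<Longrightarrow>
    exec (WhilePos a c) (R, xs, ys) (access_cost R a + t1 + t2) s''"

inductive_cases exec_elims:
  "exec Skip s t s'"
  "exec (Const d k) s t s'"
  "exec (Copy d a) s t s'"
  "exec (Add d a b) s t s'"
  "exec (Sub d a b) s t s'"
  "exec (Load d a) s t s'"
  "exec (Store d a) s t s'"
  "exec (Read d) s t s'"
  "exec (Write a) s t s'"
  "exec (Seq c1 c2) s t s'"
  "exec (IfPos a c1 c2) s t s'"
  "exec (WhilePos a c) s t s'"

lemma exec_deterministic:
  "exec c s t s' \<Longrightarrow> exec c s u s'' \<Longrightarrow> t = u \<and> s' = s''"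
proof (induction arbitrary: u s'' rule: exec.induct)
  case (Seq c1 s t1 s' c2 t2 s2)
  from Seq.prems obtain u1 w u2 where
    "exec c1 s u1 w" "exec c2 w u2 s''" "u = u1 + u2" by (rule exec_elims)
  then show ?case using Seq.IH by metis
next
  case (IfTrue R a c1 xs ys t s' c2)
  from IfTrue.prems obtain v where "exec c1 (R, xs, ys) v s''" "u = access_cost R a + v"
    by (rule exec_elims) (use IfTrue.hyps in simp_all)
  then show ?case using IfTrue.IH by metis
next
  case (IfFalse R a c2 xs ys t s' c1)
  from IfFalse.prems obtain v where "exec c2 (R, xs, ys) v s''" "u = access_cost R a + v"
    by (rule exec_elims) (use IfFalse.hyps in simp_all)
  then show ?case using IfFalse.IH by metis
next
  case (WhileFalse R a c xs ys)
  from WhileFalse.prems show ?case by (rule exec_elims) (use WhileFalse.hyps in simp_all)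
next
  case (WhileTrue R a c xs ys t1 s' t2 s2)
  from WhileTrue.prems obtain v1 w v2 where
    "exec c (R, xs, ys) v1 w" "exec (WhilePos a c) w v2 s''" "u = access_cost R a + v1 + v2"
    by (rule exec_elims) (use WhileTrue.hyps in simp_all)
  then show ?case using WhileTrue.IH by metis
qed (erule exec_elims; simp)+

definition computes :: "prog \<Rightarrow> int list \<Rightarrow> nat \<Rightarrow> int list \<Rightarrow> bool" where
  "computes c xs t ys \<longleftrightarrow> (\<exists>R xs'. exec c (\<lambda>_. 0, xs, []) t (R, xs', ys))"

text \<open>
  A search problem consists of a set \<open>I\<close> of instances, an encoding \<open>enc\<close> of the instances, the set
  \<open>sol x\<close> of the solutions of an instance \<open>x\<close>, and an encoding \<open>enc_sol x\<close> of these.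
\<close>

definition solvable_in_poly_time ::
    "'a set \<Rightarrow> ('a \<Rightarrow> int list) \<Rightarrow> ('a \<Rightarrow> 'b set) \<Rightarrow> ('a \<Rightarrow> 'b \<Rightarrow> int list) \<Rightarrow> bool" where
  "solvable_in_poly_time I enc sol enc_sol \<longleftrightarrow>
     (\<exists>(c :: prog) (p :: nat poly). \<forall>x\<in>I. \<exists>t. \<exists>y\<in>sol x.
        computes c (enc x) t (enc_sol x y) \<and> t \<le> poly p (total_bit_size (enc x)))"


text \<open>
  \<^bold>\<open>Graphs.\<close>  A graph \<open>([n], E)\<close> is represented by \<open>n\<close> and its set \<open>E\<close> of edges, which are
  two-element subsets of \<open>{1..n}\<close>.
\<close>

definition graph_on :: "nat \<Rightarrow> nat set set \<Rightarrow> bool" where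
  "graph_on n E \<longleftrightarrow> (\<forall>e\<in>E. e \<subseteq> {1..n} \<and> card e = 2)"

definition complete_bipartite :: "nat \<Rightarrow> nat \<Rightarrow> nat set set" where
  "complete_bipartite r n = {{i, j} | i j. i \<in> {1..r} \<and> j \<in> {r + 1..n}}"

definition vdegree :: "nat set set \<Rightarrow> nat \<Rightarrow> nat" where
  "vdegree E i = card {e \<in> E. i \<in> e}"


text \<open>
  \<^bold>\<open>The degree sequence problem.\<close>  In an instance \<open>(n, E, f)\<close> the function \<open>f\<^sub>i\<close> is \<open>f i\<close>; its values
  outside \<open>{0..vdegree E i}\<close> are irrelevant, as they enter neither the encoding nor the objective.
\<close>

type_synonym degree_instance = "nat \<times> nat set set \<times> (nat \<Rightarrow> nat \<Rightarrow> int)"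

definition degree_instances :: "nat \<Rightarrow> degree_instance set" where
  "degree_instances r =
     {(n, E, f). n \<ge> r \<and> graph_on n E \<and> E \<subseteq> complete_bipartite r n}"

definition degree_cost :: "nat \<Rightarrow> (nat \<Rightarrow> nat \<Rightarrow> int) \<Rightarrow> nat set set \<Rightarrow> int" where
  "degree_cost n f F = (\<Sum>i = 1..n. f i (vdegree F i))"

definition optimal_subgraphs :: "degree_instance \<Rightarrow> nat set set set" where
  "optimal_subgraphs = (\<lambda>(n, E, f).
     {F. F \<subseteq> E \<and> (\<forall>F'. F' \<subseteq> E \<longrightarrow> degree_cost n f F \<le> degree_cost n f F')})"

text \<open>The \<open>0/1\<close> biadjacency matrix, listed by the vertices \<open>j\<close> of the side \<open>{r + 1..n}\<close>.\<close>

definition encode_edges :: "nat \<Rightarrow> nat \<Rightarrow> nat set set \<Rightarrow> int list" where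
  "encode_edges r n E = [of_bool ({i, j} \<in> E). j \<leftarrow> [r + 1..<n + 1], i \<leftarrow> [1..<r + 1]]"

definition encode_functions :: "nat \<Rightarrow> nat set set \<Rightarrow> (nat \<Rightarrow> nat \<Rightarrow> int) \<Rightarrow> int list" where
  "encode_functions n E f = [f i k. i \<leftarrow> [1..<n + 1], k \<leftarrow> [0..<vdegree E i + 1]]"

definition encode_instance :: "nat \<Rightarrow> degree_instance \<Rightarrow> int list" where
  "encode_instance r = (\<lambda>(n, E, f). int n # encode_edges r n E @ encode_functions n E f)"

definition encode_subgraph :: "nat \<Rightarrow> degree_instance \<Rightarrow> nat set set \<Rightarrow> int list" where
  "encode_subgraph r = (\<lambda>(n, E, f) F. encode_edges r n F)"

end

theory Submission
  imports Defs
begin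

text \<open>
  The algorithm is a dynamic program over the right vertices; its states are the degree vectors of the
  left side, of which there are at most \<open>(n + 1) ^ r\<close>, a polynomial number for fixed \<open>r\<close>.  The table
  assigns to each vector \<open>d\<close> of offsets the least value of \<open>\<Sum>\<^sub>u f\<^sub>u (d\<^sub>u + deg\<^sub>S u)\<close>, where \<open>S\<close> ranges
  over the subsets of the edges considered so far and \<open>u\<close> over the vertices considered so far.  Two
  operations suffice.

  \<^item> A new vertex \<open>v\<close> adds a coordinate: the entry for \<open>d\<close> grows by \<open>f\<^sub>v (d\<^sub>v)\<close>, because no edge at \<open>v\<close>
    has been considered yet (lemma \<open>tab_extend\<close>).

  \<^item> An edge \<open>e\<close> is either left out or taken, and taking it amounts to raising the offsets of its two
    endpoints: the entry for \<open>d\<close> becomes the minimum of the entries for \<open>d\<close> and for \<open>d\<close> raised at the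
    endpoints of \<open>e\<close> (lemmas \<open>opt_edge\<close> and \<open>tab_relax\<close>).

  The left vertices are added first.  Then each right vertex is added, its edges are processed, and
  its coordinate is dropped again by setting it to \<open>0\<close>; so tables have at most \<open>r + 1\<close> coordinates.  In
  the end the entry for the offset \<open>0\<close> is the optimum.  Since vectors are indexed in a mixed radix
  system, both operations are simple loops over an array without multiplication or division.  Each
  entry also carries the chosen edge set as the digits of a binary number, so the solution is
  recovered without tracing back through earlier tables.

  The running time is bounded in two steps.  The number of elementary actions is polynomial
  (\<open>optimize_spec\<close>).  As addition and subtraction lengthen numbers by at most one bit, the logarithmic
  cost is at most quadratic in the number of actions and the input size (\<open>steps_exec\<close>).
\<close>

section \<open>Unit cost against logarithmic cost\<close>

text \<open>
  The same machine, but every elementary action costs one unit.  Counting actions needs no knowledge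
  of the sizes of the numbers involved.
\<close>

inductive steps :: "prog \<Rightarrow> config \<Rightarrow> nat \<Rightarrow> config \<Rightarrow> bool" where
  Skip: "steps Skip s 1 s"
| Const: "steps (Const d k) (R, xs, ys) 1 (R(d := k), xs, ys)"
| Copy: "steps (Copy d a) (R, xs, ys) 1 (R(d := R a), xs, ys)"
| Add: "steps (Add d a b) (R, xs, ys) 1 (R(d := R a + R b), xs, ys)"
| Sub: "steps (Sub d a b) (R, xs, ys) 1 (R(d := R a - R b), xs, ys)"
| Load: "R a \<ge> 0 \<Longrightarrow> steps (Load d a) (R, xs, ys) 1 (R(d := R (nat (R a))), xs, ys)"
| Store: "R d \<ge> 0 \<Longrightarrow> steps (Store d a) (R, xs, ys) 1 (R(nat (R d) := R a), xs, ys)"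
| Read: "steps (Read d) (R, x # xs, ys) 1 (R(d := x), xs, ys)"
| Write: "steps (Write a) (R, xs, ys) 1 (R, xs, ys @ [R a])"
| Seq: "steps c1 s k1 s' \<Longrightarrow> steps c2 s' k2 s'' \<Longrightarrow> steps (Seq c1 c2) s (k1 + k2) s''"
| IfTrue: "R a > 0 \<Longrightarrow> steps c1 (R, xs, ys) k s' \<Longrightarrow> steps (IfPos a c1 c2) (R, xs, ys) (Suc k) s'"
| IfFalse: "R a \<le> 0 \<Longrightarrow> steps c2 (R, xs, ys) k s' \<Longrightarrow> steps (IfPos a c1 c2) (R, xs, ys) (Suc k) s'"
| WhileFalse: "R a \<le> 0 \<Longrightarrow> steps (WhilePos a c) (R, xs, ys) 1 (R, xs, ys)"
| WhileTrue: "R a > 0 \<Longrightarrow> steps c (R, xs, ys) k1 s' \<Longrightarrow> steps (WhilePos a c) s' k2 s'' \<Longrightarrow>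
    steps (WhilePos a c) (R, xs, ys) (Suc (k1 + k2)) s''"

inductive_cases steps_elims:
  "steps Skip s k s'"
  "steps (Const d v) s k s'"
  "steps (Copy d a) s k s'"
  "steps (Add d a b) s k s'"
  "steps (Sub d a b) s k s'"
  "steps (Load d a) s k s'"
  "steps (Store d a) s k s'"
  "steps (Read d) s k s'"
  "steps (Write a) s k s'"
  "steps (Seq c1 c2) s k s'"
  "steps (IfPos a c1 c2) s k s'"
  "steps (WhilePos a c) s k s'"

text \<open>
  The sizes of all constants and register addresses in the program text; each of them is charged
  whenever it is used, so this sum bounds the static part of the cost of a single action.
\<close>

primrec prog_bits :: "prog \<Rightarrow> nat" where
  "prog_bits Skip = 1"
| "prog_bits (Const d k) = bit_size (int d) + bit_size k"
| "prog_bits (Copy d a) = bit_size (int d) + bit_size (int a)"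
| "prog_bits (Add d a b) = bit_size (int d) + bit_size (int a) + bit_size (int b)"
| "prog_bits (Sub d a b) = bit_size (int d) + bit_size (int a) + bit_size (int b)"
| "prog_bits (Load d a) = bit_size (int d) + bit_size (int a)"
| "prog_bits (Store d a) = bit_size (int d) + bit_size (int a)"
| "prog_bits (Read d) = bit_size (int d)"
| "prog_bits (Write a) = bit_size (int a)"
| "prog_bits (Seq c1 c2) = prog_bits c1 + prog_bits c2"
| "prog_bits (IfPos a c1 c2) = bit_size (int a) + prog_bits c1 + prog_bits c2"
| "prog_bits (WhilePos a c) = bit_size (int a) + prog_bits c"

definition fits :: "nat \<Rightarrow> config \<Rightarrow> bool" where
  "fits b = (\<lambda>(R, xs, ys). (\<forall>a. bit_size (R a) \<le> b) \<and> (\<forall>x\<in>set xs. bit_size x \<le> b))"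

lemma fits_mono: "fits b s \<Longrightarrow> b \<le> b' \<Longrightarrow> fits b' s"
  by (cases s) (auto simp: fits_def intro: order_trans)

lemma bit_size_le_iff: "0 < b \<Longrightarrow> bit_size z \<le> b \<longleftrightarrow> \<bar>z\<bar> < 2 ^ (b - 1)"
proof -
  assume "0 < b"
  have "floorlog 2 (nat \<bar>z\<bar>) \<le> b - 1 \<longleftrightarrow> nat \<bar>z\<bar> < 2 ^ (b - 1)"
    by (simp add: floorlog_le_iff)
  also have "\<dots> \<longleftrightarrow> \<bar>z\<bar> < 2 ^ (b - 1)"
    by (simp add: nat_less_iff)
  finally show ?thesis using \<open>0 < b\<close> unfolding bit_size_def by auto
qed

lemma bit_size_pos: "0 < bit_size z"
  by (simp add: bit_size_def)

lemma bit_size_add: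
  assumes "bit_size x \<le> b" "bit_size y \<le> b"
  shows "bit_size (x + y) \<le> Suc b" "bit_size (x - y) \<le> Suc b"
proof -
  have b: "0 < b" using assms(1) bit_size_pos[of x] by linarith
  then have "(2::int) ^ (Suc b - 1) = 2 * 2 ^ (b - 1)"
    by (cases b) auto
  then show "bit_size (x + y) \<le> Suc b" "bit_size (x - y) \<le> Suc b"
    using assms b by (auto simp: bit_size_le_iff)
qed

lemma fits_update:
  "fits b (R, xs, ys) \<Longrightarrow> bit_size v \<le> Suc b \<Longrightarrow> fits (Suc b) (R(d := v), xs, ys)"
  by (auto simp: fits_def intro: le_SucI)

lemma fits_output: "fits b (R, xs, ys) \<Longrightarrow> fits (Suc b) (R, xs, ys')"
  by (auto simp: fits_def intro: le_SucI)

text \<open>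
  The only arithmetic operations are addition and subtraction, so an action lengthens the largest
  number by at most one bit.  Starting from numbers of at most \<open>b\<close> bits, all numbers have at most
  \<open>b + k\<close> bits throughout \<open>k\<close> actions, and one action touches at most five numbers.  Hence it
  suffices to count unit steps.
\<close>

lemma steps_exec:
  assumes "steps c s k s'"
  shows "fits b s \<Longrightarrow> prog_bits c \<le> b \<Longrightarrow>
    \<exists>t. exec c s t s' \<and> t \<le> 5 * k * (b + k) \<and> fits (b + k) s'"
  using assms
proof (induction arbitrary: b rule: steps.induct)
  case (Skip s)
  then show ?case using exec.Skip[of s] by (intro exI[of _ 1]) (auto intro: fits_mono)
next
  case (Const d k R xs ys)
  show ?case
    by (intro exI conjI, rule exec.Const) (use Const in \<open>auto intro: fits_update\<close>)
next
  case (Copy d a R xs ys)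
  then have "bit_size (R a) \<le> b" by (auto simp: fits_def)
  note * = this Copy
  show ?case
    by (intro exI conjI, rule exec.Copy)
      (use * in \<open>auto simp: access_cost_def intro: fits_update fits_output le_SucI\<close>)
next
  case (Add d a b' R xs ys)
  then have "bit_size (R a) \<le> b" "bit_size (R b') \<le> b" by (auto simp: fits_def)
  note * = this Add
  show ?case
    by (intro exI conjI, rule exec.Add)
      (use * in \<open>auto simp: access_cost_def bit_size_add intro!: fits_update\<close>)
next
  case (Sub d a b' R xs ys)
  then have "bit_size (R a) \<le> b" "bit_size (R b') \<le> b" by (auto simp: fits_def)
  note * = this Sub
  show ?case
    by (intro exI conjI, rule exec.Sub)
      (use * in \<open>auto simp: access_cost_def bit_size_add intro!: fits_update\<close>)
next
  case (Load R a d xs ys)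
  then have "bit_size (R a) \<le> b" "bit_size (R (nat (R a))) \<le> b" by (auto simp: fits_def)
  note * = this Load
  show ?case
    by (intro exI conjI, rule exec.Load)
      (use * in \<open>auto simp: access_cost_def intro: fits_update fits_output le_SucI\<close>)
next
  case (Store R d a xs ys)
  then have "bit_size (R a) \<le> b" "bit_size (R d) \<le> b" by (auto simp: fits_def)
  note * = this Store
  show ?case
    by (intro exI conjI, rule exec.Store)
      (use * in \<open>auto simp: access_cost_def intro: fits_update fits_output le_SucI\<close>)
next
  case (Read d R x xs ys)
  note * = this
  show ?case
    by (intro exI conjI, rule exec.Read)
      (use * in \<open>auto simp: fits_def intro: le_SucI\<close>)
next
  case (Write a R xs ys)
  then have "bit_size (R a) \<le> b" by (auto simp: fits_def)
  note * = this Write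
  show ?case
    by (intro exI conjI, rule exec.Write)
      (use * in \<open>auto simp: access_cost_def intro: fits_update fits_output le_SucI\<close>)
next
  case (Seq c1 s k1 s' c2 k2 s'')
  then obtain t1 where t1: "exec c1 s t1 s'" "t1 \<le> 5 * k1 * (b + k1)" "fits (b + k1) s'"
    by fastforce
  obtain t2 where t2: "exec c2 s' t2 s''" "t2 \<le> 5 * k2 * (b + k1 + k2)" "fits (b + k1 + k2) s''"
    using Seq(4)[OF t1(3)] Seq(6) by auto
  have "t1 + t2 \<le> 5 * (k1 + k2) * (b + (k1 + k2))"
    using t1(2) t2(2) by (simp add: algebra_simps)
  with exec.Seq[OF t1(1) t2(1)] t2(3) show ?case by (auto simp: add.assoc)
next
  case (IfTrue R a c1 xs ys k s' c2)
  then obtain t where t: "exec c1 (R, xs, ys) t s'" "t \<le> 5 * k * (b + k)" "fits (b + k) s'"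
    by fastforce
  have "bit_size (R a) \<le> b" using IfTrue by (auto simp: fits_def)
  then have "access_cost R a + t \<le> 5 * Suc k * (b + Suc k)"
    using t(2) IfTrue(5) by (simp add: access_cost_def algebra_simps)
  with exec.IfTrue[OF IfTrue(1) t(1), of c2] t(3) show ?case
    by (intro exI[of _ "access_cost R a + t"]) (auto intro: fits_mono[of "b + k"])
next
  case (IfFalse R a c2 xs ys k s' c1)
  then obtain t where t: "exec c2 (R, xs, ys) t s'" "t \<le> 5 * k * (b + k)" "fits (b + k) s'"
    by fastforce
  have "bit_size (R a) \<le> b" using IfFalse by (auto simp: fits_def)
  then have "access_cost R a + t \<le> 5 * Suc k * (b + Suc k)"
    using t(2) IfFalse(5) by (simp add: access_cost_def algebra_simps)
  with exec.IfFalse[OF IfFalse(1) t(1), of c1] t(3) show ?case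
    by (intro exI[of _ "access_cost R a + t"]) (auto intro: fits_mono[of "b + k"])
next
  case (WhileFalse R a c xs ys)
  then have "bit_size (R a) \<le> b" by (auto simp: fits_def)
  note * = this WhileFalse
  show ?case
    by (intro exI conjI, rule exec.WhileFalse)
      (use * in \<open>auto simp: access_cost_def intro: fits_update fits_output le_SucI\<close>)
next
  case (WhileTrue R a c xs ys k1 s' k2 s'')
  then obtain t1 where t1: "exec c (R, xs, ys) t1 s'" "t1 \<le> 5 * k1 * (b + k1)" "fits (b + k1) s'"
    by fastforce
  obtain t2 where t2: "exec (WhilePos a c) s' t2 s''" "t2 \<le> 5 * k2 * (b + k1 + k2)"
      "fits (b + k1 + k2) s''"
    using WhileTrue(5)[OF t1(3)] WhileTrue(7) by auto
  have "bit_size (R a) \<le> b" using WhileTrue by (auto simp: fits_def)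
  then have "access_cost R a + t1 + t2 \<le> 5 * Suc (k1 + k2) * (b + Suc (k1 + k2))"
    using t1(2) t2(2) WhileTrue(7) by (simp add: access_cost_def algebra_simps)
  with exec.WhileTrue[OF WhileTrue(1) t1(1) t2(1)] t2(3) show ?case
    by (intro exI[of _ "access_cost R a + t1 + t2"])
      (auto intro: fits_mono[of "b + k1 + k2"])
qed

section \<open>Weakest preconditions with step counts\<close>

text \<open>
  The postcondition also receives the number of steps.  Every program construct has an equation for
  this predicate transformer, so straight-line code can be verified by rewriting.
\<close>

definition wp :: "prog \<Rightarrow> (nat \<Rightarrow> config \<Rightarrow> bool) \<Rightarrow> config \<Rightarrow> bool" where
  "wp c Q s \<longleftrightarrow> (\<exists>k s'. steps c s k s' \<and> Q k s')"

lemma wp_mono: "wp c Q s \<Longrightarrow> (\<And>k s'. Q k s' \<Longrightarrow> Q' k s') \<Longrightarrow> wp c Q' s"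
  unfolding wp_def by blast

lemma wp_primitive [simp]:
  "wp Skip Q s \<longleftrightarrow> Q 1 s"
  "wp (Const d v) Q (R, xs, ys) \<longleftrightarrow> Q 1 (R(d := v), xs, ys)"
  "wp (Copy d a) Q (R, xs, ys) \<longleftrightarrow> Q 1 (R(d := R a), xs, ys)"
  "wp (Add d a b) Q (R, xs, ys) \<longleftrightarrow> Q 1 (R(d := R a + R b), xs, ys)"
  "wp (Sub d a b) Q (R, xs, ys) \<longleftrightarrow> Q 1 (R(d := R a - R b), xs, ys)"
  "wp (Load d a) Q (R, xs, ys) \<longleftrightarrow> R a \<ge> 0 \<and> Q 1 (R(d := R (nat (R a))), xs, ys)"
  "wp (Store d a) Q (R, xs, ys) \<longleftrightarrow> R d \<ge> 0 \<and> Q 1 (R(nat (R d) := R a), xs, ys)"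
  "wp (Read d) Q (R, x # xs, ys) \<longleftrightarrow> Q 1 (R(d := x), xs, ys)"
  "wp (Write a) Q (R, xs, ys) \<longleftrightarrow> Q 1 (R, xs, ys @ [R a])"
  unfolding wp_def by (safe elim!: steps_elims; (auto; fail | rule exI conjI | rule steps.intros | assumption)+)+

lemma wp_Seq [simp]:
  "wp (Seq c1 c2) Q s \<longleftrightarrow> wp c1 (\<lambda>k1. wp c2 (\<lambda>k2. Q (k1 + k2))) s"
  unfolding wp_def by (blast intro: steps.Seq elim: steps_elims(10))

lemma wp_IfPos [simp]:
  "wp (IfPos a c1 c2) Q (R, xs, ys) \<longleftrightarrow>
     wp (if R a > 0 then c1 else c2) (\<lambda>k. Q (Suc k)) (R, xs, ys)"
proof
  assume "wp (IfPos a c1 c2) Q (R, xs, ys)"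
  then obtain k s' where "steps (IfPos a c1 c2) (R, xs, ys) k s'" "Q k s'"
    by (auto simp: wp_def)
  then show "wp (if R a > 0 then c1 else c2) (\<lambda>k. Q (Suc k)) (R, xs, ys)"
    unfolding wp_def by (auto elim!: steps_elims(11) simp del: split_paired_Ex)
next
  assume "wp (if R a > 0 then c1 else c2) (\<lambda>k. Q (Suc k)) (R, xs, ys)"
  then obtain k s' where "steps (if R a > 0 then c1 else c2) (R, xs, ys) k s'" "Q (Suc k) s'"
    unfolding wp_def by blast
  moreover from this(1) have "steps (IfPos a c1 c2) (R, xs, ys) (Suc k) s'"
    by (cases "R a > 0") (auto intro: steps.IfTrue steps.IfFalse)
  ultimately show "wp (IfPos a c1 c2) Q (R, xs, ys)"
    unfolding wp_def by blast
qed

lemma wp_WhilePos: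
  "wp (WhilePos a c) Q (R, xs, ys) \<longleftrightarrow>
     (if R a > 0 then wp c (\<lambda>k1. wp (WhilePos a c) (\<lambda>k2. Q (Suc (k1 + k2)))) (R, xs, ys)
      else Q 1 (R, xs, ys))"
proof
  assume "wp (WhilePos a c) Q (R, xs, ys)"
  then obtain k s' where "steps (WhilePos a c) (R, xs, ys) k s'" "Q k s'"
    by (auto simp: wp_def)
  from this(1) show "if R a > 0 then wp c (\<lambda>k1. wp (WhilePos a c) (\<lambda>k2. Q (Suc (k1 + k2)))) (R, xs, ys)
      else Q 1 (R, xs, ys)"
  proof (rule steps_elims(12), goal_cases)
    case 2 then show ?case using \<open>Q k s'\<close> unfolding wp_def by (auto simp del: split_paired_Ex)
  qed (use \<open>Q k s'\<close> in simp)
next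
  assume *: "if R a > 0 then wp c (\<lambda>k1. wp (WhilePos a c) (\<lambda>k2. Q (Suc (k1 + k2)))) (R, xs, ys)
      else Q 1 (R, xs, ys)"
  show "wp (WhilePos a c) Q (R, xs, ys)"
  proof (cases "R a > 0")
    case True
    with * show ?thesis unfolding wp_def by simp (blast intro: steps.WhileTrue)
  next
    case False
    with * show ?thesis unfolding wp_def using steps.WhileFalse[of R a c xs ys] by auto
  qed
qed

text \<open>
  The loop register counts down while the invariant is indexed by the number of completed rounds.
\<close>

lemma wp_count:
  assumes body: "\<And>i R xs ys. i < N \<Longrightarrow> I i R xs ys \<Longrightarrow> R a = int (N - i) \<Longrightarrow>
      wp c (\<lambda>k (R', xs', ys'). k \<le> B \<and> I (Suc i) R' xs' ys' \<and> R' a = int (N - Suc i)) (R, xs, ys)"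
    and init: "I 0 R xs ys" "R a = int N"
  shows "wp (WhilePos a c)
    (\<lambda>k (R', xs', ys'). k \<le> N * Suc B + 1 \<and> I N R' xs' ys' \<and> R' a = 0) (R, xs, ys)"
proof -
  have "wp (WhilePos a c) (\<lambda>k (R', xs', ys'). k \<le> m * Suc B + 1 \<and> I N R' xs' ys' \<and> R' a = 0)
      (R, xs, ys)" if "m \<le> N" "I (N - m) R xs ys" "R a = int m" for m R xs ys
    using that
  proof (induction m arbitrary: R xs ys)
    case 0
    then show ?case by (subst wp_WhilePos) simp
  next
    case (Suc m)
    have *: "N - Suc m < N" "Suc (N - Suc m) = N - m" "N - (N - m) = m" "N - (N - Suc m) = Suc m"
      using Suc.prems(1) by auto
    have "wp c (\<lambda>k (R', xs', ys'). k \<le> B \<and> I (N - m) R' xs' ys' \<and> R' a = int m) (R, xs, ys)"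
      using body[OF *(1) Suc.prems(2)] Suc.prems(3) * by simp
    then have "wp c (\<lambda>k1. wp (WhilePos a c) (\<lambda>k2 s. case s of (R', xs', ys') \<Rightarrow>
        Suc (k1 + k2) \<le> Suc m * Suc B + 1 \<and> I N R' xs' ys' \<and> R' a = 0)) (R, xs, ys)"
    proof (rule wp_mono)
      fix k s assume "case s of (R', xs', ys') \<Rightarrow> k \<le> B \<and> I (N - m) R' xs' ys' \<and> R' a = int m"
      then obtain R' xs' ys' where k: "s = (R', xs', ys')" "k \<le> B" "I (N - m) R' xs' ys'"
        "R' a = int m" by auto
      show "wp (WhilePos a c) (\<lambda>k2 s. case s of (R', xs', ys') \<Rightarrow>
        Suc (k + k2) \<le> Suc m * Suc B + 1 \<and> I N R' xs' ys' \<and> R' a = 0) s"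
        unfolding k(1) by (rule wp_mono[OF Suc.IH[OF _ k(3,4)]]) (use Suc.prems k(2) in auto)
    qed
    with Suc.prems(3) show ?case by (subst wp_WhilePos) (simp del: of_nat_Suc)
  qed
  from this[of N] init show ?thesis by simp
qed

primrec block :: "prog list \<Rightarrow> prog" where
  "block [] = Skip"
| "block (c # cs) = Seq c (block cs)"

text \<open>
  The number of left vertices is a constant of the program, so iterations over them are unrolled;
  their registers then have fixed addresses.
\<close>

lemma wp_unroll:
  assumes body: "\<And>i R xs ys. i < N \<Longrightarrow> I i R xs ys \<Longrightarrow>
      wp (c i) (\<lambda>k (R', xs', ys'). k \<le> B \<and> I (Suc i) R' xs' ys') (R, xs, ys)"
    and init: "I 0 R xs ys"
  shows "wp (block (map c [0..<N]))
    (\<lambda>k (R', xs', ys'). k \<le> N * B + 1 \<and> I N R' xs' ys') (R, xs, ys)"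
proof -
  have "wp (block (map c [N - m..<N])) (\<lambda>k (R', xs', ys'). k \<le> m * B + 1 \<and> I N R' xs' ys')
      (R, xs, ys)" if "m \<le> N" "I (N - m) R xs ys" for m R xs ys
    using that
  proof (induction m arbitrary: R xs ys)
    case (Suc m)
    have *: "N - Suc m < N" "Suc (N - Suc m) = N - m" using Suc.prems(1) by auto
    have "[N - Suc m..<N] = (N - Suc m) # [N - m..<N]" using * by (metis upt_conv_Cons)
    moreover have "wp (c (N - Suc m)) (\<lambda>k1. wp (block (map c [N - m..<N])) (\<lambda>k2 s. case s of
        (R', xs', ys') \<Rightarrow> k1 + k2 \<le> Suc m * B + 1 \<and> I N R' xs' ys')) (R, xs, ys)"
    proof (rule wp_mono[OF body[OF *(1) Suc.prems(2)]])
      fix k s assume "case s of (R', xs', ys') \<Rightarrow> k \<le> B \<and> I (Suc (N - Suc m)) R' xs' ys'"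
      then obtain R' xs' ys' where k: "s = (R', xs', ys')" "k \<le> B" "I (N - m) R' xs' ys'"
        using *(2) by auto
      show "wp (block (map c [N - m..<N])) (\<lambda>k2 s. case s of
        (R', xs', ys') \<Rightarrow> k + k2 \<le> Suc m * B + 1 \<and> I N R' xs' ys') s"
        unfolding k(1) by (rule wp_mono[OF Suc.IH[OF _ k(3)]]) (use Suc.prems k(2) in auto)
    qed
    ultimately show ?case by simp
  qed simp
  from this[of N] init show ?thesis by simp
qed

section \<open>Degree tables\<close>

text \<open>
  Vertices are numbered from \<open>0\<close>: the left ones are \<open>0, \<dots>, r - 1\<close>, the right ones
  \<open>r, \<dots>, r + q - 1\<close>.  The entries of the biadjacency matrix are numbered row by row by positions
  \<open>p < q * r\<close>, and \<open>P\<close> is the set of positions of the edges of \<open>H\<close>, so that subgraphs of \<open>H\<close> are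
  subsets of \<open>P\<close>.
\<close>

locale degree_table =
  fixes r q :: nat and P :: "nat set" and f :: "nat \<Rightarrow> nat \<Rightarrow> int"
  assumes r_pos: "0 < r" and P_bound: "P \<subseteq> {..<q * r}"
begin

definition lft :: "nat \<Rightarrow> nat" where "lft p = p mod r"

definition rgt :: "nat \<Rightarrow> nat" where "rgt p = r + p div r"

definition deg :: "nat set \<Rightarrow> nat \<Rightarrow> nat" where
  "deg S u = card {p \<in> S. lft p = u \<or> rgt p = u}"

abbreviation D :: "nat \<Rightarrow> nat" where "D \<equiv> deg P"

text \<open>
  The objective of \<open>S\<close> restricted to the first \<open>v\<close> vertices, if vertex \<open>u\<close> already has degree \<open>d u\<close>
  from elsewhere.
\<close>

definition cost :: "nat \<Rightarrow> (nat \<Rightarrow> nat) \<Rightarrow> nat set \<Rightarrow> int" where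
  "cost v d S = (\<Sum>u<v. f u (d u + deg S u))"

text \<open>
  The number whose \<open>t\<close> binary digits are the characteristic vector of \<open>S\<close>, position \<open>0\<close> being the
  most significant digit.  A new position is thereby appended by doubling.
\<close>

definition code :: "nat \<Rightarrow> nat set \<Rightarrow> int" where
  "code t S = (\<Sum>p\<in>S. 2 ^ (t - Suc p))"

text \<open>
  The table entry for \<open>d\<close> once the positions below \<open>t\<close> have been considered: \<open>c\<close> is the least cost
  that a set of those positions can reach on top of the offset \<open>d\<close>, and \<open>x\<close> is the code of a set that
  reaches it.
\<close>

definition opt :: "nat \<Rightarrow> nat \<Rightarrow> (nat \<Rightarrow> nat) \<Rightarrow> int \<Rightarrow> int \<Rightarrow> bool" where
  "opt t v d c x \<longleftrightarrow> (\<exists>S \<subseteq> P \<inter> {..<t}. c = cost v d S \<and> x = code t S \<and>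
     (\<forall>S' \<subseteq> P \<inter> {..<t}. c \<le> cost v d S'))"

text \<open>
  Tables use a mixed radix system: the digit of vertex \<open>u\<close> is its offset \<open>d u\<close>, which ranges over
  \<open>0, \<dots>, D u\<close>.  Only the left vertices and the current right vertex have a digit; the latter always
  has the place value \<open>sz r\<close>, which is why \<open>sz\<close> stops growing at \<open>r\<close>.  An entry is a pair of numbers,
  cost and code, so place values double when they are measured in registers, as in \<open>wt\<close>.
\<close>

definition sz :: "nat \<Rightarrow> nat" where
  "sz u = (\<Prod>i<min u r. D i + 1)"

definition wt :: "nat \<Rightarrow> nat" where
  "wt u = 2 * sz u"

definition idx :: "nat \<Rightarrow> (nat \<Rightarrow> nat) \<Rightarrow> nat" where
  "idx v d = (\<Sum>u<v. wt u * d u)"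

text \<open>
  The table for the first \<open>v\<close> vertices and the positions below \<open>t\<close>, stored from address \<open>tb\<close> on.
  Entries are required to be correct only for offsets that leave room for all edges at \<open>u\<close> considered
  so far.  For a right vertex with a finished row this forces \<open>d u = 0\<close>, so its digit disappears by
  itself although \<open>idx\<close> formally sums over all vertices.
\<close>

definition tab :: "nat \<Rightarrow> nat \<Rightarrow> nat \<Rightarrow> (nat \<Rightarrow> int) \<Rightarrow> bool" where
  "tab v t tb M \<longleftrightarrow> (\<forall>d. (\<forall>u<v. d u + deg (P \<inter> {..<t}) u \<le> D u) \<longrightarrow>
     opt t v d (M (tb + idx v d)) (M (tb + idx v d + 1)))"

lemma lft_less: "lft p < r"
  using r_pos by (simp add: lft_def)

lemma rgt_ge: "r \<le> rgt p"
  by (simp add: rgt_def)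

lemma lft_neq_rgt: "lft p \<noteq> rgt p"
  using lft_less[of p] rgt_ge[of p] by simp

lemma finite_P: "finite P"
  using P_bound finite_subset by blast

lemma deg_insert:
  assumes "finite S" "t \<notin> S"
  shows "deg (insert t S) u = deg S u + (if u = lft t \<or> u = rgt t then 1 else 0)"
proof -
  have "{p \<in> insert t S. lft p = u \<or> rgt p = u} =
    (if u = lft t \<or> u = rgt t then insert t {p \<in> S. lft p = u \<or> rgt p = u}
     else {p \<in> S. lft p = u \<or> rgt p = u})" by auto
  then show ?thesis using assms by (simp add: deg_def)
qed

lemma deg_step:
  "deg (P \<inter> {..<Suc t}) u = deg (P \<inter> {..<t}) u + of_bool (t \<in> P \<and> (u = lft t \<or> u = rgt t))"
proof (cases "t \<in> P")
  case True
  then have "P \<inter> {..<Suc t} = insert t (P \<inter> {..<t})" by (auto simp: less_Suc_eq)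
  with True show ?thesis using deg_insert[of "P \<inter> {..<t}" t u] by simp
next
  case False
  then have "P \<inter> {..<Suc t} = P \<inter> {..<t}" by (auto simp: less_Suc_eq)
  with False show ?thesis by simp
qed

text \<open>
  All positions in the row of vertex \<open>u\<close> have been considered.
\<close>

lemma deg_done:
  assumes "r \<le> u" "(u - r + 1) * r \<le> t"
  shows "deg (P \<inter> {..<t}) u = D u"
proof -
  have "p < t" if "lft p = u \<or> rgt p = u" for p
  proof -
    have "p div r = u - r" using that lft_less[of p] assms(1) by (auto simp: rgt_def)
    then have "p < (u - r + 1) * r" using r_pos
      by (metis Suc_eq_plus1 div_less_iff_less_mult lessI)
    with assms(2) show ?thesis by simp
  qed
  then have "{p \<in> P \<inter> {..<t}. lft p = u \<or> rgt p = u} = {p \<in> P. lft p = u \<or> rgt p = u}"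
    by auto
  then show ?thesis by (simp add: deg_def)
qed

text \<open>
  No position at vertex \<open>u\<close> has been considered yet.
\<close>

lemma deg_fresh:
  assumes "t = 0 \<or> r \<le> u \<and> t \<le> (u - r) * r" "S \<subseteq> {..<t}"
  shows "deg S u = 0"
proof -
  have False if "p \<in> S" "lft p = u \<or> rgt p = u" for p
  proof -
    have "p < t" using that assms(2) by auto
    then have "r \<le> u" "t \<le> (u - r) * r" using assms(1) by auto
    then have "p div r = u - r" using that lft_less[of p] by (auto simp: rgt_def)
    then have "(u - r) * r \<le> p" by (metis div_times_less_eq_dividend)
    with \<open>t \<le> _\<close> \<open>p < t\<close> show False by simp
  qed
  then have "{p \<in> S. lft p = u \<or> rgt p = u} = {}" by blast
  then show ?thesis unfolding deg_def by (simp only: card.empty)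
qed

lemma code_Suc:
  assumes "S \<subseteq> {..<t}"
  shows "code (Suc t) S = 2 * code t S" "code (Suc t) (insert t S) = 2 * code t S + 1"
proof -
  show *: "code (Suc t) S = 2 * code t S"
    unfolding code_def sum_distrib_left
  proof (rule sum.cong)
    fix p assume "p \<in> S"
    then have "p < t" using assms by auto
    then have "Suc t - Suc p = Suc (t - Suc p)" by simp
    then show "(2::int) ^ (Suc t - Suc p) = 2 * 2 ^ (t - Suc p)" by (metis power_Suc)
  qed simp
  have "finite S" "t \<notin> S" using assms finite_subset by auto
  then show "code (Suc t) (insert t S) = 2 * code t S + 1"
    using * by (simp add: code_def)
qed

lemma opt_extend:
  assumes "opt t v d c x" "t = 0 \<or> r \<le> v \<and> t \<le> (v - r) * r"
  shows "opt t (Suc v) d (c + f v (d v)) x"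
proof -
  have "cost (Suc v) d S = cost v d S + f v (d v)" if "S \<subseteq> P \<inter> {..<t}" for S
    using deg_fresh[OF assms(2)] that by (simp add: cost_def)
  then show ?thesis using assms(1) unfolding opt_def by (metis add_le_cancel_right)
qed

lemma opt_skip:
  assumes "opt t v d c x" "t \<notin> P"
  shows "opt (Suc t) v d c (2 * x)"
proof -
  have eq: "P \<inter> {..<Suc t} = P \<inter> {..<t}" using assms(2) by (auto simp: less_Suc_eq)
  obtain S where S: "S \<subseteq> P \<inter> {..<t}" "c = cost v d S" "x = code t S"
    "\<forall>S' \<subseteq> P \<inter> {..<t}. c \<le> cost v d S'"
    using assms(1) unfolding opt_def by blast
  moreover have "2 * x = code (Suc t) S" using S code_Suc(1)[of S t] by simp
  ultimately show ?thesis unfolding opt_def eq by blast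
qed

lemma cost_insert:
  assumes "S \<subseteq> {..<t}"
  shows "cost v d (insert t S) =
    cost v (\<lambda>u. d u + (if u = lft t \<or> u = rgt t then 1 else 0)) S"
proof -
  have "finite S" "t \<notin> S" using assms finite_subset by auto
  then show ?thesis unfolding cost_def
    by (intro sum.cong) (simp_all add: deg_insert)
qed

text \<open>
  A set of positions either avoids \<open>t\<close>, or contains it; in the latter case its cost is that of the
  remaining set with the offsets of both endpoints raised by one.
\<close>

lemma opt_edge:
  assumes "t \<in> P" "opt t v d c x"
    "opt t v (\<lambda>u. d u + (if u = lft t \<or> u = rgt t then 1 else 0)) c' x'"
  shows "opt (Suc t) v d (if c' < c then c' else c) (if c' < c then 2 * x' + 1 else 2 * x)"
proof -
  let ?d = "\<lambda>u. d u + (if u = lft t \<or> u = rgt t then 1 else 0)"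
  obtain S where S: "S \<subseteq> P \<inter> {..<t}" "c = cost v d S" "x = code t S"
    "\<And>S'. S' \<subseteq> P \<inter> {..<t} \<Longrightarrow> c \<le> cost v d S'"
    using assms(2) unfolding opt_def by auto
  obtain T where T: "T \<subseteq> P \<inter> {..<t}" "c' = cost v ?d T" "x' = code t T"
    "\<And>S'. S' \<subseteq> P \<inter> {..<t} \<Longrightarrow> c' \<le> cost v ?d S'"
    using assms(3) unfolding opt_def by auto
  have min: "min c c' \<le> cost v d S'" if S': "S' \<subseteq> P \<inter> {..<Suc t}" for S'
  proof (cases "t \<in> S'")
    case True
    then have "S' = insert t (S' - {t})" "S' - {t} \<subseteq> P \<inter> {..<t}"
      using S' by (auto simp: less_Suc_eq)
    then have "cost v d S' = cost v ?d (S' - {t})"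
      using cost_insert[of "S' - {t}" t v d] by simp
    with T(4)[OF \<open>S' - {t} \<subseteq> _\<close>] show ?thesis by simp
  next
    case False
    then have "S' \<subseteq> P \<inter> {..<t}" using S' by (auto simp: less_Suc_eq)
    with S(4)[OF this] show ?thesis by simp
  qed
  show ?thesis
  proof (cases "c' < c")
    case True
    have "insert t T \<subseteq> P \<inter> {..<Suc t}" using T(1) assms(1) by auto
    moreover have "c' = cost v d (insert t T)" "2 * x' + 1 = code (Suc t) (insert t T)"
      using T cost_insert[of T t v d] code_Suc(2)[of T t] by auto
    moreover have "\<forall>S' \<subseteq> P \<inter> {..<Suc t}. c' \<le> cost v d S'"
      using min True by simp
    ultimately have "opt (Suc t) v d c' (2 * x' + 1)" unfolding opt_def by blast
    with True show ?thesis by simp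
  next
    case False
    have "S \<subseteq> P \<inter> {..<Suc t}" using S(1) by auto
    moreover have "2 * x = code (Suc t) S" using S code_Suc(1)[of S t] by auto
    moreover have "\<forall>S' \<subseteq> P \<inter> {..<Suc t}. c \<le> cost v d S'"
      using min False by simp
    ultimately have "opt (Suc t) v d c (2 * x)" using S(2) unfolding opt_def by blast
    with False show ?thesis by simp
  qed
qed

lemma sz_0: "sz 0 = 1"
  by (simp add: sz_def)

lemma sz_Suc: "v < r \<Longrightarrow> sz (Suc v) = sz v * (D v + 1)"
  by (simp add: sz_def min_def)

lemma sz_const: "r \<le> v \<Longrightarrow> sz v = sz r"
  by (simp add: sz_def min_def)

lemma sz_pos: "0 < sz v"
  by (simp add: sz_def prod_pos)

lemma even_wt: "even (wt v)"
  by (simp add: wt_def)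

lemma even_idx: "even (idx v d)"
  by (simp add: idx_def dvd_sum even_wt)

lemma idx_less_step:
  assumes "idx v d < wt v" "d v \<le> D v"
  shows "idx (Suc v) d < wt v * (D v + 1)"
proof -
  have "wt v * d v \<le> wt v * D v" using assms(2) by simp
  moreover have "idx (Suc v) d = idx v d + wt v * d v" by (simp add: idx_def)
  ultimately have "idx (Suc v) d < wt v + wt v * D v" using assms(1) by linarith
  then show ?thesis by simp
qed

lemma idx_less:
  assumes "\<And>u. u < v \<Longrightarrow> d u \<le> D u" "\<And>u. r \<le> u \<Longrightarrow> u < v \<Longrightarrow> d u = 0"
  shows "idx v d < wt v"
  using assms
proof (induction v)
  case 0
  then show ?case by (simp add: idx_def wt_def sz_0)
next
  case (Suc v)
  then have IH: "idx v d < wt v" by auto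
  show ?case
  proof (cases "v < r")
    case True
    with idx_less_step[OF IH] Suc.prems(1) show ?thesis by (simp add: wt_def sz_Suc)
  next
    case False
    then have "d v = 0" using Suc.prems(2) by auto
    with IH False show ?thesis using sz_const[of v] sz_const[of "Suc v"]
      by (simp add: idx_def wt_def)
  qed
qed

lemma idx_add_edge:
  assumes "rgt t < v"
  shows "idx v (\<lambda>u. d u + (if u = lft t \<or> u = rgt t then 1 else 0)) =
    idx v d + (wt (lft t) + wt (rgt t))"
proof -
  have "lft t < v" using assms lft_less[of t] rgt_ge[of t] by linarith
  have "idx v (\<lambda>u. d u + (if u = lft t \<or> u = rgt t then 1 else 0)) =
    (\<Sum>u<v. wt u * d u + ((if u = lft t then wt u else 0) + (if u = rgt t then wt u else 0)))"
    unfolding idx_def using lft_neq_rgt[of t] by (intro sum.cong) (auto simp: algebra_simps)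
  also have "\<dots> = idx v d + (wt (lft t) + wt (rgt t))"
    using \<open>lft t < v\<close> assms by (simp add: sum.distrib idx_def)
  finally show ?thesis .
qed

lemma tab_init: "M tb = 0 \<Longrightarrow> M (tb + 1) = 0 \<Longrightarrow> tab 0 0 tb M"
  by (simp add: tab_def opt_def idx_def cost_def code_def)

text \<open>
  A vertex without considered edges contributes \<open>f v c\<close> for the offset \<open>c\<close> regardless of the chosen
  set.  So the new table consists of one copy of the old table for each \<open>c\<close>, with \<open>f v c\<close> added to the
  costs.
\<close>

lemma tab_extend:
  assumes tab: "tab v t tb M"
    and t: "t = 0 \<and> v \<le> r \<or> r \<le> v \<and> t = (v - r) * r"
    and M': "\<And>c y. c \<le> D v \<Longrightarrow> y < wt v \<Longrightarrow>
      M' (tb' + c * wt v + y) = M (tb + y) + (if even y then f v c else 0)"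
  shows "tab (Suc v) t tb' M'"
  unfolding tab_def
proof (intro allI impI)
  fix d assume d: "\<forall>u<Suc v. d u + deg (P \<inter> {..<t}) u \<le> D u"
  have "idx v d < wt v"
  proof (rule idx_less)
    fix u assume u: "r \<le> u" "u < v"
    then have "(u - r + 1) * r \<le> t"
      using t by (auto simp: not_le simp del: mult_Suc)
    from deg_done[OF u(1) this] d u(2) show "d u = 0" by (metis add_le_same_cancel2 le_zero_eq less_SucI)
  qed (meson d add_leD1 less_SucI)
  then have *: "idx v d + 1 < wt v"
    using even_idx[of v d] even_wt[of v]
    by (metis Suc_eq_plus1 Suc_lessI even_Suc)
  have "d v \<le> D v" using d by force
  have "opt t v d (M (tb + idx v d)) (M (tb + idx v d + 1))"
    using tab d unfolding tab_def by auto
  from opt_extend[OF this] t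
  have "opt t (Suc v) d (M (tb + idx v d) + f v (d v)) (M (tb + idx v d + 1))"
    by fastforce
  moreover have "tb' + idx (Suc v) d = tb' + d v * wt v + idx v d"
    by (simp add: idx_def)
  ultimately show "opt t (Suc v) d (M' (tb' + idx (Suc v) d)) (M' (tb' + idx (Suc v) d + 1))"
    using M'[OF \<open>d v \<le> D v\<close>, of "idx v d"] M'[OF \<open>d v \<le> D v\<close>, of "idx v d + 1"] * even_idx[of v d]
    by (simp add: add.assoc)
qed

text \<open>
  Raising the offsets of the endpoints of position \<open>t\<close> shifts the index by a constant, so the
  recurrence for an edge compares each entry with the one at a fixed positive distance.  If \<open>d\<close> is
  admissible after position \<open>t\<close>, the raised offset is admissible before it; hence entries beyond the
  table, and other meaningless ones, never influence the entries that matter.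
\<close>

lemma tab_relax:
  assumes tab: "tab (Suc v) t tb M"
    and v: "rgt t = v"
    and M': "\<And>y. 2 * y < wt v * (D v + 1) \<Longrightarrow>
      (M' (tb + 2 * y), M' (tb + 2 * y + 1)) =
      (let y' = tb + 2 * y + (wt (lft t) + wt v) in
       if t \<in> P \<and> M y' < M (tb + 2 * y) then (M y', 2 * M (y' + 1) + 1)
       else (M (tb + 2 * y), 2 * M (tb + 2 * y + 1)))"
  shows "tab (Suc v) (Suc t) tb M'"
  unfolding tab_def
proof (intro allI impI)
  fix d assume d: "\<forall>u<Suc v. d u + deg (P \<inter> {..<Suc t}) u \<le> D u"
  let ?e = "\<lambda>u. if u = lft t \<or> u = rgt t then 1 else (0::nat)"
  have step: "deg (P \<inter> {..<Suc t}) u = deg (P \<inter> {..<t}) u + (if t \<in> P then ?e u else 0)" for u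
    by (simp add: deg_step)
  have "idx v d < wt v"
  proof (rule idx_less)
    fix u assume u: "r \<le> u" "u < v"
    then have "u - r < t div r" using v by (auto simp: rgt_def)
    then have "(u - r + 1) * r \<le> Suc t"
      by (metis Suc_eq_plus1 Suc_leI div_times_less_eq_dividend le_SucI le_trans mult_le_mono1)
    from deg_done[OF u(1) this] d u(2) show "d u = 0" by (metis add_le_same_cancel2 le_zero_eq less_SucI)
  qed (meson d add_leD1 less_SucI)
  moreover have "d v \<le> D v" using d by force
  ultimately have less: "idx (Suc v) d < wt v * (D v + 1)" by (rule idx_less_step)
  obtain y where y: "idx (Suc v) d = 2 * y" using even_idx[of "Suc v" d] by (auto elim: evenE)
  have old: "opt t (Suc v) d (M (tb + 2 * y)) (M (tb + 2 * y + 1))"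
    using tab d unfolding tab_def y[symmetric] step by (metis add_leD1 add.assoc)
  show "opt (Suc t) (Suc v) d (M' (tb + idx (Suc v) d)) (M' (tb + idx (Suc v) d + 1))"
  proof (cases "t \<in> P")
    case True
    let ?y = "tb + 2 * y + (wt (lft t) + wt v)"
    have "\<forall>u<Suc v. (d u + ?e u) + deg (P \<inter> {..<t}) u \<le> D u"
      using d True by (auto simp: step)
    then have new: "opt t (Suc v) (\<lambda>u. d u + ?e u) (M (tb + idx (Suc v) (\<lambda>u. d u + ?e u)))
        (M (tb + idx (Suc v) (\<lambda>u. d u + ?e u) + 1))"
      using tab[unfolded tab_def, THEN spec, of "\<lambda>u. d u + ?e u"] by (rule mp[rotated])
    have "idx (Suc v) (\<lambda>u. d u + ?e u) = 2 * y + (wt (lft t) + wt v)"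
      using idx_add_edge[of t "Suc v" d] unfolding y v by simp
    then have "tb + idx (Suc v) (\<lambda>u. d u + ?e u) = ?y"
      by linarith
    note new' = new[unfolded this]
    have *: "(M' (tb + 2 * y), M' (tb + 2 * y + 1)) =
      (if M ?y < M (tb + 2 * y) then (M ?y, 2 * M (?y + 1) + 1)
       else (M (tb + 2 * y), 2 * M (tb + 2 * y + 1)))"
      using M'[of y] less True unfolding y Let_def by presburger
    show ?thesis
    proof (cases "M ?y < M (tb + 2 * y)")
      case less: True
      with * have "M' (tb + 2 * y) = M ?y" "M' (tb + 2 * y + 1) = 2 * M (?y + 1) + 1" by simp_all
      with opt_edge[OF True old new'] less show ?thesis unfolding y by presburger
    next
      case False
      with * have "M' (tb + 2 * y) = M (tb + 2 * y)"
        "M' (tb + 2 * y + 1) = 2 * M (tb + 2 * y + 1)" by simp_all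
      with opt_edge[OF True old new'] False show ?thesis unfolding y by presburger
    qed
  next
    case False
    with opt_skip[OF old False] show ?thesis
      using M'[of y] less unfolding y by (simp add: Let_def)
  qed
qed

end

section \<open>Table operations on the machine\<close>

text \<open>
  Registers below \<open>30\<close> are variables.  Registers \<open>30 + i\<close> and \<open>30 + r + i\<close> hold the weight and the
  degree of the left vertex \<open>i\<close>.  The biadjacency matrix is stored from \<open>30 + 2 * r\<close> on and is followed
  by the tables, each new one behind its predecessor.
\<close>

abbreviation (input) ONE :: nat where "ONE \<equiv> 2"
abbreviation (input) ZERO :: nat where "ZERO \<equiv> 3"
abbreviation (input) ROW :: nat where "ROW \<equiv> 4"
abbreviation (input) EDGE :: nat where "EDGE \<equiv> 5"
abbreviation (input) CNT :: nat where "CNT \<equiv> 6"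
abbreviation (input) TAB :: nat where "TAB \<equiv> 7"
abbreviation (input) LEN :: nat where "LEN \<equiv> 8"
abbreviation (input) NTAB :: nat where "NTAB \<equiv> 9"
abbreviation (input) NLEN :: nat where "NLEN \<equiv> 10"
abbreviation (input) SRC :: nat where "SRC \<equiv> 11"
abbreviation (input) DST :: nat where "DST \<equiv> 12"
abbreviation (input) CTR :: nat where "CTR \<equiv> 13"
abbreviation (input) VAL :: nat where "VAL \<equiv> 14"
abbreviation (input) BIT :: nat where "BIT \<equiv> 15"
abbreviation (input) ACC :: nat where "ACC \<equiv> 16"
abbreviation (input) AUX :: nat where "AUX \<equiv> 17"
abbreviation (input) OLEN :: nat where "OLEN \<equiv> 18"
abbreviation (input) POW :: nat where "POW \<equiv> 19"
abbreviation (input) ROWS :: nat where "ROWS \<equiv> 20"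
abbreviation (input) SHIFT :: nat where "SHIFT \<equiv> 21"

definition copy_pair :: prog where
  "copy_pair = block [
     Load BIT SRC, Add BIT BIT VAL, Store DST BIT, Add SRC SRC ONE, Add DST DST ONE,
     Load BIT SRC, Store DST BIT, Add SRC SRC ONE, Add DST DST ONE, Sub CTR CTR ONE]"

definition copy_table :: prog where
  "copy_table = block [
     Read VAL, Copy SRC TAB, Copy CTR LEN, WhilePos CTR copy_pair, Add NLEN NLEN LEN, Sub CNT CNT ONE]"

text \<open>
  Builds the table with one more vertex behind the current one, reading the \<open>CNT + 1\<close> values of the
  function of this vertex from the input.
\<close>

definition extend :: prog where
  "extend = block [
     Add NTAB TAB LEN, Add NTAB NTAB LEN, Copy DST NTAB, Const NLEN 0, Add CNT CNT ONE,
     WhilePos CNT copy_table, Copy TAB NTAB, Copy LEN NLEN]"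

text \<open>
  The entry is compared with the one at distance \<open>SHIFT\<close> if the current position is an edge, that is,
  if \<open>BIT\<close> is positive.  In either case the code receives a new last digit.
\<close>

definition relax_pair :: prog where
  "relax_pair = block [
     Add SRC DST SHIFT, Load ACC DST, Load AUX SRC, Sub ACC ACC AUX, IfPos BIT Skip (Const ACC 0),
     IfPos ACC
       (block [Store DST AUX, Add SRC SRC ONE, Add DST DST ONE,
          Load AUX SRC, Add AUX AUX AUX, Add AUX AUX ONE, Store DST AUX])
       (block [Add DST DST ONE, Load AUX DST, Add AUX AUX AUX, Store DST AUX]),
     Add DST DST ONE, Sub CTR CTR ONE]"

definition relax :: prog where
  "relax = block [Copy DST TAB, Copy CTR LEN, WhilePos CTR relax_pair]"

lemma wp_conseq:
  "wp c (\<lambda>k (R, xs, ys). G k R xs ys) s \<Longrightarrow>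
    (\<And>k R xs ys. G k R xs ys \<Longrightarrow> Q k (R, xs, ys)) \<Longrightarrow> wp c Q s"
  by (erule wp_mono) auto

lemma nat_int_1 [simp]: "nat (int a + 1) = Suc a" "nat (1 + int a) = Suc a"
  by auto

lemma copy_pair_spec:
  assumes "R SRC = int a" "R DST = int b" "R ONE = 1" "30 \<le> a" "a + 2 \<le> b"
  shows "wp copy_pair (\<lambda>k (R', xs', ys'). k \<le> 11 \<and> xs' = xs \<and> ys' = ys \<and>
    R' b = R a + R VAL \<and> R' (Suc b) = R (Suc a) \<and> R' SRC = int (a + 2) \<and> R' DST = int (b + 2) \<and>
    R' CTR = R CTR - 1 \<and> (\<forall>c. c \<notin> {SRC, DST, CTR, BIT, b, Suc b} \<longrightarrow> R' c = R c)) (R, xs, ys)"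
  using assms by (simp add: copy_pair_def)

lemma copy_loop_spec:
  assumes "R SRC = int a" "R DST = int b" "R ONE = 1" "R CTR = int l" "30 \<le> a" "a + 2 * l \<le> b"
  shows "wp (WhilePos CTR copy_pair) (\<lambda>k (R', xs', ys'). k \<le> l * 12 + 1 \<and> xs' = xs \<and> ys' = ys \<and>
    (\<forall>y < 2 * l. R' (b + y) = R (a + y) + (if even y then R VAL else 0)) \<and>
    R' DST = int (b + 2 * l) \<and>
    (\<forall>c < b. c \<notin> {SRC, DST, CTR, BIT} \<longrightarrow> R' c = R c)) (R, xs, ys)"
proof -
  define I where "I i R' xs' ys' \<longleftrightarrow> xs' = xs \<and> ys' = ys \<and>
    (\<forall>y < 2 * i. R' (b + y) = R (a + y) + (if even y then R VAL else 0)) \<and>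
    R' SRC = int (a + 2 * i) \<and> R' DST = int (b + 2 * i) \<and>
    (\<forall>c < b. c \<notin> {SRC, DST, CTR, BIT} \<longrightarrow> R' c = R c)" for i R' xs' ys'
  have "wp (WhilePos CTR copy_pair)
      (\<lambda>k (R', xs', ys'). k \<le> l * Suc 11 + 1 \<and> I l R' xs' ys' \<and> R' CTR = 0) (R, xs, ys)"
  proof (rule wp_count)
    show "I 0 R xs ys" using assms by (simp add: I_def)
    fix i R1 xs1 ys1 assume i: "i < l" and I: "I i R1 xs1 ys1" and K: "R1 CTR = int (l - i)"
    have V: "R1 VAL = R VAL" and one: "R1 ONE = 1" using I assms unfolding I_def by auto
    show "wp copy_pair (\<lambda>k (R', xs', ys'). k \<le> 11 \<and> I (Suc i) R' xs' ys' \<and>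
      R' CTR = int (l - Suc i)) (R1, xs1, ys1)"
    proof (rule wp_conseq[OF copy_pair_spec[of R1 "a + 2 * i" "b + 2 * i"]], goal_cases)
      case (6 k R2 xs2 ys2)
      have "R1 (a + 2 * i) = R (a + 2 * i)" "R1 (Suc (a + 2 * i)) = R (Suc (a + 2 * i))"
        using I i assms unfolding I_def by auto
      with 6 have "R2 (b + y) = R (a + y) + (if even y then R VAL else 0)" if "y < 2 * Suc i" for y
        using that I i assms V unfolding I_def
        by (cases "y = 2 * i"; cases "y = Suc (2 * i)") auto
      with 6 I K i assms show ?case unfolding I_def by auto
    qed (use I one assms i in \<open>auto simp: I_def\<close>)
  qed (use assms in simp)
  then show ?thesis by (rule wp_conseq) (auto simp: I_def)
qed

text \<open>
  The new table lies above all addresses in use, so everything except for some variables survives.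
\<close>

lemma extend_spec:
  assumes "R ONE = 1" "R TAB = int tb" "R LEN = int l" "R CNT = int n" "30 \<le> tb"
    "xs = map g [0..<Suc n] @ rest"
  shows "wp extend (\<lambda>k (R', xs', ys'). k \<le> Suc n * (12 * l + 10) + 20 \<and> xs' = rest \<and> ys' = ys \<and>
    R' TAB = int (tb + 2 * l) \<and> R' LEN = int (l * Suc n) \<and>
    (\<forall>c \<le> n. \<forall>y < 2 * l. R' (tb + 2 * l + c * (2 * l) + y) =
        R (tb + y) + (if even y then g c else 0)) \<and>
    (\<forall>c < tb + 2 * l. c \<notin> {CNT, TAB, LEN, NTAB, NLEN, SRC, DST, CTR, VAL, BIT} \<longrightarrow> R' c = R c)) (R, xs, ys)"
proof -
  define b where "b = tb + 2 * l"
  define I where "I i R' xs' ys' \<longleftrightarrow> xs' = map g [i..<Suc n] @ rest \<and> ys' = ys \<and>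
    R' TAB = int tb \<and> R' LEN = int l \<and> R' NTAB = int b \<and> R' DST = int (b + i * (2 * l)) \<and>
    R' NLEN = int (l * i) \<and>
    (\<forall>c < i. \<forall>y < 2 * l. R' (b + c * (2 * l) + y) = R (tb + y) + (if even y then g c else 0)) \<and>
    (\<forall>c < b. c \<notin> {CNT, TAB, LEN, NTAB, NLEN, SRC, DST, CTR, VAL, BIT} \<longrightarrow> R' c = R c)" for i R' xs' ys'
  have loop: "wp (WhilePos CNT copy_table)
      (\<lambda>k (R', xs', ys'). k \<le> Suc n * Suc (l * 12 + 9) + 1 \<and> I (Suc n) R' xs' ys' \<and> R' CNT = 0)
      (R(NTAB := int b, DST := int b, NLEN := 0, CNT := int n + 1), xs, ys)"
  proof (rule wp_count)
    show "I 0 (R(NTAB := int b, DST := int b, NLEN := 0, CNT := int n + 1)) xs ys"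
      using assms by (simp add: I_def b_def)
    fix i R1 xs1 ys1 assume i: "i < Suc n" and I: "I i R1 xs1 ys1" and C: "R1 CNT = int (Suc n - i)"
    have one: "R1 ONE = 1" using I assms unfolding I_def b_def by auto
    have xs1: "xs1 = g i # map g [Suc i..<Suc n] @ rest"
      using I i by (simp add: I_def upt_conv_Cons del: upt_Suc)
    define R2 where "R2 = R1(VAL := g i, SRC := int tb, CTR := int l)"
    have src: "R2 (tb + y) = R (tb + y)" if "y < 2 * l" for y
      using I assms that unfolding I_def b_def R2_def by auto
    have bi: "b \<le> b + i * (2 * l)" by simp
    have regs1: "R1 TAB = int tb" "R1 LEN = int l" "ys1 = ys" using I by (auto simp: I_def)
    show "wp copy_table (\<lambda>k (R', xs', ys'). k \<le> l * 12 + 9 \<and> I (Suc i) R' xs' ys' \<and>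
           R' CNT = int (Suc n - Suc i)) (R1, xs1, ys1)"
      unfolding xs1 copy_table_def
    proof (simp add: regs1 R2_def[symmetric] del: upt_Suc,
        rule wp_conseq[OF copy_loop_spec[of R2 tb "b + i * (2 * l)" l]], goal_cases)
      case (7 k R3 xs3 ys3)
      have low: "R3 c = R2 c" if "c < b" "c \<notin> {SRC, DST, CTR, BIT}" for c
        using 7 that by auto
      have regs: "R3 TAB = int tb" "R3 LEN = int l" "R3 NTAB = int b" "R3 NLEN = int (l * i)"
         "R3 ONE = 1" "R3 CNT = int (Suc n - i)"
        using low I C one assms(5) unfolding I_def b_def R2_def by auto
      have tab: "R3 (b + c * (2 * l) + y) = R (tb + y) + (if even y then g c else 0)"
        if "c < Suc i" "y < 2 * l" for c y
      proof (cases "c = i")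
        case True
        then show ?thesis using 7 that src[of y] by (simp add: R2_def add.assoc)
      next
        case False
        then have "c < i" using that by simp
        have "c * (2 * l) + y < Suc c * (2 * l)" using that by simp
        also have "\<dots> \<le> i * (2 * l)" using \<open>c < i\<close> by (intro mult_le_mono1) simp
        finally have lt: "b + c * (2 * l) + y < b + i * (2 * l)" by simp
        have "30 \<le> b" using assms(5) by (simp add: b_def)
        then have "R3 (b + c * (2 * l) + y) = R2 (b + c * (2 * l) + y)"
          using 7 lt by auto
        also have "\<dots> = R1 (b + c * (2 * l) + y)" using \<open>30 \<le> b\<close> by (auto simp: R2_def)
        finally show ?thesis using I \<open>c < i\<close> that(2) unfolding I_def by auto
      qed
      have old: "R3 c = R c" if "c < b" "c \<notin> {CNT, TAB, LEN, NTAB, NLEN, SRC, DST, CTR, VAL, BIT}" for c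
        using low[of c] that I unfolding I_def R2_def by auto
      have big: "30 \<le> b" using assms(5) by (simp add: b_def)
      have "I (Suc i) (R3(NLEN := int (l * i) + int l, CNT := int (Suc n - i) - 1)) xs3 ys3"
        unfolding I_def using 7 regs tab old big by (auto simp: algebra_simps)
      then show ?case using 7 regs i by (simp add: of_nat_diff)
    qed (use I one assms in \<open>auto simp: I_def R2_def b_def\<close>)
  qed simp
  have b_eq: "int tb + int l + int l = int b" by (simp add: b_def)
  show ?thesis
    unfolding extend_def
  proof (simp add: assms(1-4) b_eq del: upt_Suc, rule wp_conseq[OF loop], goal_cases)
    case (1 k R' xs' ys')
    then have I: "I (Suc n) R' xs' ys'" and k: "k \<le> Suc n * Suc (l * 12 + 9) + 1" by auto
    have big: "30 \<le> b" using assms(5) by (simp add: b_def)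
    have *: "b + c * (2 * l) + y \<noteq> TAB" "b + c * (2 * l) + y \<noteq> LEN" for c y
      using big by auto
    have "k + 8 \<le> Suc n * (12 * l + 10) + 20" using k by (simp add: algebra_simps)
    moreover have "\<forall>c \<le> n. \<forall>y < 2 * l. R' (b + c * (2 * l) + y) =
        R (tb + y) + (if even y then g c else 0)"
      using I unfolding I_def by (simp add: less_Suc_eq_le)
    moreover have "xs' = rest" "ys' = ys" "R' NTAB = int b" "R' NLEN = int (l * Suc n)"
      "\<forall>c < b. c \<notin> {CNT, TAB, LEN, NTAB, NLEN, SRC, DST, CTR, VAL, BIT} \<longrightarrow> R' c = R c"
      using I unfolding I_def by simp_all
    ultimately show ?case using * by (simp add: b_def[symmetric]) (simp add: b_def)
  qed
qed

lemma relax_pair_spec: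
  assumes "R DST = int b" "R SHIFT = int \<delta>" "R ONE = 1" "30 \<le> b" "2 \<le> \<delta>"
  shows "wp relax_pair (\<lambda>k (R', xs', ys'). k \<le> 20 \<and> xs' = xs \<and> ys' = ys \<and>
    (R' b, R' (Suc b)) = (if 0 < R BIT \<and> R (b + \<delta>) < R b
       then (R (b + \<delta>), 2 * R (Suc (b + \<delta>)) + 1) else (R b, 2 * R (Suc b))) \<and>
    R' DST = int (b + 2) \<and> R' CTR = R CTR - 1 \<and>
    (\<forall>c. c \<notin> {SRC, DST, CTR, ACC, AUX, b, Suc b} \<longrightarrow> R' c = R c)) (R, xs, ys)"
proof -
  have [simp]: "nat (int b + int \<delta>) = b + \<delta>" "nat (int b + int \<delta> + 1) = Suc (b + \<delta>)" by simp_all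
  show ?thesis
    using assms by (simp add: relax_pair_def)
qed

text \<open>
  Entries are updated in place in ascending order.  As the shift is positive, each entry is compared
  with one that has not been updated yet, so the result refers to the old contents only.
\<close>

lemma relax_spec:
  assumes "R ONE = 1" "R TAB = int tb" "R LEN = int l" "R SHIFT = int \<delta>" "30 \<le> tb" "2 \<le> \<delta>"
  shows "wp relax (\<lambda>k (R', xs', ys'). k \<le> l * 21 + 4 \<and> xs' = xs \<and> ys' = ys \<and>
    (\<forall>y < l. (R' (tb + 2 * y), R' (tb + 2 * y + 1)) =
      (let y' = tb + 2 * y + \<delta> in
       if 0 < R BIT \<and> R y' < R (tb + 2 * y) then (R y', 2 * R (y' + 1) + 1)
       else (R (tb + 2 * y), 2 * R (tb + 2 * y + 1)))) \<and>
    (\<forall>c < tb. c \<notin> {SRC, DST, CTR, ACC, AUX} \<longrightarrow> R' c = R c)) (R, xs, ys)"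
proof -
  define new where "new y = (let y' = tb + 2 * y + \<delta> in
       if 0 < R BIT \<and> R y' < R (tb + 2 * y) then (R y', 2 * R (y' + 1) + 1)
       else (R (tb + 2 * y), 2 * R (tb + 2 * y + 1)))" for y
  define I where "I i R' xs' ys' \<longleftrightarrow> xs' = xs \<and> ys' = ys \<and> R' DST = int (tb + 2 * i) \<and>
    (\<forall>y < i. (R' (tb + 2 * y), R' (tb + 2 * y + 1)) = new y) \<and>
    (\<forall>c. (c < tb \<or> tb + 2 * i \<le> c) \<and> c \<notin> {SRC, DST, CTR, ACC, AUX} \<longrightarrow> R' c = R c)"
    for i and R' :: "nat \<Rightarrow> int" and xs' ys'
  have loop: "wp (WhilePos CTR relax_pair)
      (\<lambda>k (R', xs', ys'). k \<le> l * Suc 20 + 1 \<and> I l R' xs' ys' \<and> R' CTR = 0)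
      (R(DST := int tb, CTR := int l), xs, ys)"
  proof (rule wp_count)
    show "I 0 (R(DST := int tb, CTR := int l)) xs ys" using assms by (simp add: I_def)
    fix i R1 xs1 ys1 assume i: "i < l" and I: "I i R1 xs1 ys1" and K: "R1 CTR = int (l - i)"
    have regs: "R1 ONE = 1" "R1 SHIFT = int \<delta>" "R1 BIT = R BIT" "R1 DST = int (tb + 2 * i)"
      using I assms unfolding I_def by auto
    have old: "R1 c = R c" if "tb + 2 * i \<le> c" for c
      using I assms that unfolding I_def by auto
    show "wp relax_pair (\<lambda>k (R', xs', ys'). k \<le> 20 \<and> I (Suc i) R' xs' ys' \<and>
      R' CTR = int (l - Suc i)) (R1, xs1, ys1)"
    proof (rule wp_conseq[OF relax_pair_spec[of R1 "tb + 2 * i" \<delta>]], goal_cases)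
      case (6 k R2 xs2 ys2)
      then have frame: "R2 c = R1 c"
        if "c \<notin> {SRC, DST, CTR, ACC, AUX, tb + 2 * i, Suc (tb + 2 * i)}" for c
        using that by blast
      have "(R2 (tb + 2 * y), R2 (tb + 2 * y + 1)) = new y" if "y < Suc i" for y
      proof (cases "y = i")
        case True
        then show ?thesis using 6 by (simp add: new_def Let_def old regs)
      next
        case False
        then have "y < i" using that by simp
        then have "R2 (tb + 2 * y) = R1 (tb + 2 * y)" "R2 (tb + 2 * y + 1) = R1 (tb + 2 * y + 1)"
          using assms(5) by (auto intro!: frame) presburger
        with I \<open>y < i\<close> show ?thesis unfolding I_def by simp
      qed
      moreover have "R2 c = R c" if "c < tb \<or> tb + 2 * Suc i \<le> c"
        "c \<notin> {SRC, DST, CTR, ACC, AUX}" for c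
        using that I frame[of c] unfolding I_def by auto
      ultimately show ?case using 6 I K i unfolding I_def by auto
    qed (use regs assms in auto)
  qed simp
  show ?thesis
    unfolding relax_def
  proof (simp add: assms(2,3), rule wp_conseq[OF loop], goal_cases)
    case (1 k R' xs' ys')
    then show ?case unfolding I_def new_def[symmetric] by auto
  qed
qed

section \<open>The program\<close>

text \<open>
  Stores the matrix entry and updates the degree of its left vertex.  \<open>POW\<close> is doubled for every
  position and finally is \<open>2\<close> to the number of positions.
\<close>

definition read_edge :: "nat \<Rightarrow> nat \<Rightarrow> prog" where
  "read_edge r i = block [
     Read BIT, Store EDGE BIT, Add EDGE EDGE ONE, Add (30 + r + i) (30 + r + i) BIT, Add POW POW POW]"

definition read_row :: "nat \<Rightarrow> prog" where
  "read_row r = block [block (map (read_edge r) [0..<r]), Sub ROW ROW ONE]"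

definition read_phase :: "nat \<Rightarrow> prog" where
  "read_phase r = block [
     Const ONE 1, Const POW 1, Read ROWS, Const BIT (int r), Sub ROWS ROWS BIT,
     Const EDGE (int (30 + 2 * r)), Copy ROW ROWS, WhilePos ROW (read_row r)]"

definition left_vertex :: "nat \<Rightarrow> nat \<Rightarrow> prog" where
  "left_vertex r i = block [Add (30 + i) LEN LEN, Copy CNT (30 + r + i), extend]"

text \<open>
  The initial table has no vertices and a single entry \<open>(0, 0)\<close>.  The left vertices are added before
  any position is considered.
\<close>

definition left_phase :: "nat \<Rightarrow> prog" where
  "left_phase r = block [
     Copy TAB EDGE, Store TAB ZERO, Add ACC TAB ONE, Store ACC ZERO, Const LEN 1,
     block (map (left_vertex r) [0..<r])]"

definition count_edge :: prog where
  "count_edge = block [Load BIT ACC, Add CNT CNT BIT, Add ACC ACC ONE]"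

definition relax_edge :: "nat \<Rightarrow> prog" where
  "relax_edge i = block [
     Load BIT EDGE, Add EDGE EDGE ONE, Add SHIFT (30 + i) OLEN, Add SHIFT SHIFT OLEN, relax]"

text \<open>
  The degree of the right vertex is counted first, as it tells how many function values to read.
  Afterwards only the part of the table with digit \<open>0\<close> for this vertex is kept, by resetting \<open>LEN\<close>.
\<close>

definition right_vertex :: "nat \<Rightarrow> prog" where
  "right_vertex r = block [
     Const CNT 0, Copy ACC EDGE, block (map (\<lambda>_. count_edge) [0..<r]),
     Copy OLEN LEN, extend, block (map relax_edge [0..<r]), Copy LEN OLEN, Sub ROW ROW ONE]"

definition right_phase :: "nat \<Rightarrow> prog" where
  "right_phase r = block [
     Const EDGE (int (30 + 2 * r)), Copy ROW ROWS, WhilePos ROW (right_vertex r)]"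

text \<open>
  The next digit of the code is its most significant one.  After doubling, it is read off by a
  comparison with the fixed power \<open>POW\<close>; this avoids halving, which the machine does not have.
\<close>

definition write_edge :: prog where
  "write_edge = block [
     Add BIT BIT BIT, Sub ACC POW BIT,
     IfPos ACC (Write ZERO) (block [Sub BIT BIT POW, Write ONE])]"

definition write_row :: "nat \<Rightarrow> prog" where
  "write_row r = block [block (map (\<lambda>_. write_edge) [0..<r]), Sub ROW ROW ONE]"

definition write_phase :: "nat \<Rightarrow> prog" where
  "write_phase r = block [
     Add ACC TAB ONE, Load BIT ACC, Copy ROW ROWS, WhilePos ROW (write_row r)]"

definition optimize :: "nat \<Rightarrow> prog" where
  "optimize r = block [read_phase r, left_phase r, right_phase r, write_phase r]"

section \<open>Correctness and step count\<close>

context degree_table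
begin

lemma lft_rgt_row: "i < r \<Longrightarrow> lft (j * r + i) = i" "i < r \<Longrightarrow> rgt (j * r + i) = r + j"
  by (simp_all add: lft_def rgt_def)

text \<open>
  The part of the input that lists the functions of the vertices from \<open>u\<close> on.
\<close>

definition stream :: "nat \<Rightarrow> int list" where
  "stream u = concat (map (\<lambda>u. map (f u) [0..<Suc (D u)]) [u..<r + q])"

lemma stream_step: "u < r + q \<Longrightarrow> stream u = map (f u) [0..<Suc (D u)] @ stream (Suc u)"
  by (simp add: stream_def upt_conv_Cons del: upt_Suc)

text \<open>
  What stays unchanged after the matrix has been read.
\<close>

definition ctx :: "(nat \<Rightarrow> int) \<Rightarrow> bool" where
  "ctx R \<longleftrightarrow> R ONE = 1 \<and> R ZERO = 0 \<and> R POW = 2 ^ (q * r) \<and> R ROWS = int q \<and>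
     (\<forall>i<r. R (30 + r + i) = int (D i)) \<and> (\<forall>p<q * r. R (30 + 2 * r + p) = of_bool (p \<in> P))"

lemma ctx_frame:
  assumes "ctx R" "\<And>c. c \<in> {ONE, ZERO, POW, ROWS} \<or> 30 + r \<le> c \<and> c < 30 + 2 * r + q * r \<Longrightarrow> R' c = R c"
  shows "ctx R'"
  using assms unfolding ctx_def by auto

lemma row_less: "j < q \<Longrightarrow> i < r \<Longrightarrow> j * r + i < q * r"
proof -
  assume "j < q" "i < r"
  then have "j * r + i < Suc j * r" by simp
  also have "\<dots> \<le> q * r" using \<open>j < q\<close> by (intro mult_le_mono1) simp
  finally show ?thesis .
qed

definition read_inv :: "nat \<Rightarrow> (nat \<Rightarrow> int) \<Rightarrow> int list \<Rightarrow> int list \<Rightarrow> bool" where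
  "read_inv p R xs ys \<longleftrightarrow> xs = map (\<lambda>p. of_bool (p \<in> P)) [p..<q * r] @ stream 0 \<and> ys = [] \<and>
     R ONE = 1 \<and> R ZERO = 0 \<and> R ROWS = int q \<and> R EDGE = int (30 + 2 * r + p) \<and> R POW = 2 ^ p \<and>
     (\<forall>i<r. R (30 + r + i) = int (deg (P \<inter> {..<p}) i)) \<and>
     (\<forall>p'<p. R (30 + 2 * r + p') = of_bool (p' \<in> P))"

lemma read_edge_run:
  assumes "R EDGE = int e" "R ONE = 1" "30 + r + i < e"
  shows "wp (read_edge r i) (\<lambda>k s. k \<le> 6 \<and> s =
    (R(BIT := x, e := x, EDGE := int e + 1, 30 + r + i := R (30 + r + i) + x, POW := R POW + R POW),
     xs, ys)) (R, x # xs, ys)"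
proof -
  define d where "d = 30 + r + i"
  have "30 \<le> d" "d < e" using assms(3) by (simp_all add: d_def)
  then show ?thesis
    unfolding read_edge_def d_def[symmetric] using assms(1,2) by simp
qed

lemma read_edge_spec:
  assumes "j < q" "i < r" and I: "read_inv (j * r + i) R xs ys"
  shows "wp (read_edge r i) (\<lambda>k (R', xs', ys'). k \<le> 6 \<and>
    read_inv (j * r + Suc i) R' xs' ys' \<and> R' ROW = R ROW) (R, xs, ys)"
proof -
  let ?p = "j * r + i"
  have xs: "xs = of_bool (?p \<in> P) # map (\<lambda>p. of_bool (p \<in> P)) [Suc ?p..<q * r] @ stream 0"
    using I row_less[OF assms(1,2)] by (simp add: read_inv_def upt_conv_Cons)
  define R' where "R' = R(BIT := of_bool (?p \<in> P), 30 + 2 * r + ?p := of_bool (?p \<in> P),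
    EDGE := int (30 + 2 * r + ?p) + 1, 30 + r + i := R (30 + r + i) + of_bool (?p \<in> P), POW := R POW + R POW)"
  have 1: "R' (30 + r + i') = int (deg (P \<inter> {..<Suc ?p}) i')" if "i' < r" for i'
    using I that assms(2) unfolding read_inv_def R'_def
    by (auto simp: deg_step lft_rgt_row)
  have 2: "R' (30 + 2 * r + p') = of_bool (p' \<in> P)" if "p' < Suc ?p" for p'
    using I that assms(2) unfolding read_inv_def R'_def
    by (cases "p' = ?p") auto
  have 3: "R' ONE = 1" "R' ZERO = 0" "R' ROWS = int q" "R' EDGE = int (30 + 2 * r + Suc ?p)"
    "R' POW = 2 ^ Suc ?p" "R' ROW = R ROW"
    using I assms(2) unfolding read_inv_def R'_def by auto
  have "R ONE = 1" "R EDGE = int (30 + 2 * r + ?p)" "ys = []" using I unfolding read_inv_def by auto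
  then have "wp (read_edge r i) (\<lambda>k s. k \<le> 6 \<and>
      s = (R', map (\<lambda>p. of_bool (p \<in> P)) [Suc ?p..<q * r] @ stream 0, [])) (R, xs, ys)"
    unfolding xs R'_def using read_edge_run[of R "30 + 2 * r + ?p" i] assms(2) by simp
  then show ?thesis
    by (rule wp_mono) (use 1 2 3 in \<open>auto simp: read_inv_def\<close>)
qed

lemma read_phase_spec:
  "wp (read_phase r) (\<lambda>k (R, xs, ys). k \<le> q * (r * 6 + 4) + 10 \<and> ctx R \<and> xs = stream 0 \<and> ys = [] \<and>
     R EDGE = int (30 + 2 * r + q * r))
   (\<lambda>_. 0, int (r + q) # map (\<lambda>p. of_bool (p \<in> P)) [0..<q * r] @ stream 0, [])"
proof -
  define R0 :: "nat \<Rightarrow> int" where "R0 = (\<lambda>_. 0)(ONE := 1, POW := 1, BIT := int r, ROWS := int q,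
     EDGE := 30 + 2 * int r, ROW := int q)"
  have loop: "wp (WhilePos ROW (read_row r))
    (\<lambda>k (R', xs', ys'). k \<le> q * Suc (r * 6 + 1 + 2) + 1 \<and> read_inv (q * r) R' xs' ys' \<and> R' ROW = 0)
    (R0, map (\<lambda>p. of_bool (p \<in> P)) [0..<q * r] @ stream 0, [])"
  proof (rule wp_count[where I = "\<lambda>j. read_inv (j * r)"])
    show "read_inv (0 * r) R0 (map (\<lambda>p. of_bool (p \<in> P)) [0..<q * r] @ stream 0) []"
      by (simp add: read_inv_def R0_def deg_def)
    fix j R xs ys assume j: "j < q" and I: "read_inv (j * r) R xs ys" and ROW: "R ROW = int (q - j)"
    have *: "wp (block (map (read_edge r) [0..<r])) (\<lambda>k (R', xs', ys'). k \<le> r * 6 + 1 \<and>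
        (read_inv (j * r + r) R' xs' ys' \<and> R' ROW = R ROW)) (R, xs, ys)"
    proof (rule wp_unroll[where I = "\<lambda>i R' xs' ys'. read_inv (j * r + i) R' xs' ys' \<and> R' ROW = R ROW"])
      fix i R1 xs1 ys1 assume "i < r" "read_inv (j * r + i) R1 xs1 ys1 \<and> R1 ROW = R ROW"
      then show "wp (read_edge r i) (\<lambda>k (R', xs', ys'). k \<le> 6 \<and>
          (read_inv (j * r + Suc i) R' xs' ys' \<and> R' ROW = R ROW)) (R1, xs1, ys1)"
        using read_edge_spec[OF j, of i R1 xs1 ys1] by simp
    qed (use I in simp)
    show "wp (read_row r) (\<lambda>k (R', xs', ys'). k \<le> r * 6 + 1 + 2 \<and>
        read_inv (Suc j * r) R' xs' ys' \<and> R' ROW = int (q - Suc j)) (R, xs, ys)"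
      unfolding read_row_def
    proof (simp, rule wp_conseq[OF *], goal_cases)
      case (1 k R' xs' ys')
      then show ?case using j ROW by (auto simp: read_inv_def add.commute)
    qed
  qed (simp add: R0_def)
  show ?thesis
    unfolding read_phase_def
  proof (simp add: R0_def[symmetric], rule wp_conseq[OF loop], goal_cases)
    case (1 k R xs ys)
    have "P \<inter> {..<q * r} = P" using P_bound by auto
    with 1 show ?case by (auto simp: read_inv_def ctx_def algebra_simps)
  qed
qed

text \<open>
  All degrees are at most \<open>q * r\<close>, and a table has at most \<open>r + 1\<close> digits; so this bounds the number
  of entries of every table.  It is polynomial in \<open>q\<close> since \<open>r\<close> is fixed.
\<close>

definition table_bound :: nat where "table_bound = (q * r + 1) ^ (r + 1)"

lemma D_le: "D u \<le> q * r"
proof -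
  have "D u \<le> card P" unfolding deg_def using finite_P by (intro card_mono) auto
  also have "\<dots> \<le> card {..<q * r}" using P_bound by (intro card_mono) auto
  finally show ?thesis by simp
qed

lemma sz_times_deg_le: "sz v * Suc (D u) \<le> table_bound"
proof -
  have "sz v \<le> (\<Prod>i<min v r. q * r + 1)" unfolding sz_def using D_le by (intro prod_mono) auto
  also have "\<dots> \<le> (q * r + 1) ^ r" by (simp add: power_increasing del: power_Suc)
  finally have "sz v * Suc (D u) \<le> (q * r + 1) ^ r * (q * r + 1)"
    using D_le[of u] by (intro mult_le_mono) auto
  then show ?thesis by (simp add: table_bound_def mult.commute)
qed

lemma extend_budget: "Suc (D u) * (12 * sz v + 10) + 20 \<le> 42 * table_bound"
proof -
  have "Suc (D u) \<le> sz v * Suc (D u)" using sz_pos[of v] mult_le_mono1[of 1 "sz v" "Suc (D u)"]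
    by (simp add: Suc_le_eq)
  then have "Suc (D u) \<le> table_bound" "1 \<le> table_bound" using sz_times_deg_le[of v u] by linarith+
  have *: "12 * x + 10 * y + 20 \<le> 42 * z" if "x \<le> z" "y \<le> z" "1 \<le> z" for x y z :: nat
    using that by simp
  have "Suc (D u) * (12 * sz v + 10) = 12 * (sz v * Suc (D u)) + 10 * Suc (D u)"
    by (simp add: algebra_simps)
  then show ?thesis
    using *[OF sz_times_deg_le[of v u] \<open>Suc (D u) \<le> table_bound\<close> \<open>1 \<le> table_bound\<close>] by (simp only:)
qed

lemma relax_budget: "sz v * Suc (D u) * 21 + 4 \<le> 25 * table_bound"
  using sz_times_deg_le[of v u] sz_pos[of v] by (auto intro: order_trans simp: Suc_le_eq)

lemma tab_cong: "tab v t tb M \<Longrightarrow> (\<And>a. tb \<le> a \<Longrightarrow> M' a = M a) \<Longrightarrow> tab v t tb M'"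
  by (simp add: tab_def)

definition left_inv :: "nat \<Rightarrow> (nat \<Rightarrow> int) \<Rightarrow> int list \<Rightarrow> int list \<Rightarrow> bool" where
  "left_inv i R xs ys \<longleftrightarrow> ctx R \<and> xs = stream i \<and> ys = [] \<and> R LEN = int (sz i) \<and>
     (\<forall>i'<i. R (30 + i') = int (wt i')) \<and>
     (\<exists>tb. R TAB = int tb \<and> 30 + 2 * r + q * r \<le> tb \<and> tab i 0 tb R)"

lemma left_vertex_spec:
  assumes i: "i < r" and I: "left_inv i R xs ys"
  shows "wp (left_vertex r i) (\<lambda>k (R', xs', ys'). k \<le> 42 * table_bound + 3 \<and> left_inv (Suc i) R' xs' ys')
    (R, xs, ys)"
proof -
  obtain tb where tb: "R TAB = int tb" "30 + 2 * r + q * r \<le> tb" "tab i 0 tb R"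
    using I by (auto simp: left_inv_def)
  define R1 where "R1 = R(30 + i := int (wt i), CNT := int (D i))"
  have regs: "R LEN = int (sz i)" "R (30 + r + i) = int (D i)" "ctx R"
    using I i by (auto simp: left_inv_def ctx_def)
  have r_nonzero: "r \<noteq> 0" using r_pos by simp
  have eq: "int (sz i) + int (sz i) = int (wt i)" by (simp add: wt_def)
  have tab1: "tab i 0 tb R1"
    using tab_cong[OF tb(3), of R1] tb(2) i by (simp add: R1_def)
  have ctx1: "ctx R1" using \<open>ctx R\<close> by (rule ctx_frame) (use i in \<open>auto simp: R1_def\<close>)
  have xs: "xs = map (f i) [0..<Suc (D i)] @ stream (Suc i)"
    using I i stream_step[of i] by (simp add: left_inv_def del: upt_Suc)
  have pre: "R1 ONE = 1" "R1 TAB = int tb" "R1 LEN = int (sz i)" "R1 CNT = int (D i)" "30 \<le> tb"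
    using ctx1 tb regs by (auto simp: R1_def ctx_def)
  show ?thesis
    unfolding left_vertex_def
  proof (simp add: regs eq r_nonzero R1_def[symmetric], rule wp_conseq[OF extend_spec[OF pre xs]], goal_cases)
    case (1 k R' xs' ys')
    then have R': "k \<le> Suc (D i) * (12 * sz i + 10) + 20" "xs' = stream (Suc i)" "ys' = ys"
      "R' TAB = int (tb + 2 * sz i)" "R' LEN = int (sz i * Suc (D i))"
      "\<And>c y. c \<le> D i \<Longrightarrow> y < 2 * sz i \<Longrightarrow> R' (tb + 2 * sz i + c * (2 * sz i) + y) =
        R1 (tb + y) + (if even y then f i c else 0)"
      "\<And>c. c < tb + 2 * sz i \<Longrightarrow> c \<notin> {CNT, TAB, LEN, NTAB, NLEN, SRC, DST, CTR, VAL, BIT} \<Longrightarrow>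
        R' c = R1 c"
      by blast+
    have "tab (Suc i) 0 (tb + 2 * sz i) R'"
      using tab1 by (rule tab_extend) (use i R'(6) in \<open>auto simp: wt_def\<close>)
    moreover have "ctx R'" using ctx1 by (rule ctx_frame) (use R'(7) tb(2) in auto)
    moreover have "R' (30 + i') = int (wt i')" if "i' < Suc i" for i'
      using that I i R'(7)[of "30 + i'"] tb(2) unfolding left_inv_def R1_def
      by (cases "i' = i") auto
    moreover have "k + 3 \<le> 42 * table_bound + 3" using R'(1) extend_budget[of i i] by linarith
    ultimately show ?case using R'(2-5) I tb(2) sz_Suc[OF i] unfolding left_inv_def
      by (auto simp: ac_simps)
  qed
qed

lemma left_phase_spec:
  assumes "ctx R" "R EDGE = int (30 + 2 * r + q * r)"
  shows "wp (left_phase r) (\<lambda>k (R', xs', ys'). k \<le> r * (42 * table_bound + 3) + 10 \<and> left_inv r R' xs' ys')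
    (R, stream 0, [])"
proof -
  define tb where "tb = 30 + 2 * r + q * r"
  define R1 where "R1 = R(TAB := int tb, tb := 0, ACC := int tb + 1, Suc tb := 0, LEN := 1)"
  have regs: "R EDGE = int tb" "R ONE = 1" "R ZERO = 0" "30 \<le> tb"
    using assms by (auto simp: tb_def ctx_def)
  have init: "left_inv 0 R1 (stream 0) []"
  proof -
    have "ctx R1" using assms(1) by (rule ctx_frame) (auto simp: R1_def tb_def)
    moreover have "tab 0 0 tb R1" using regs by (intro tab_init) (auto simp: R1_def)
    moreover have "R1 TAB = int tb" "R1 LEN = 1" using regs by (auto simp: R1_def)
    ultimately show ?thesis
      unfolding left_inv_def by (auto simp: sz_0 tb_def intro!: exI[of _ tb])
  qed
  have loop: "wp (block (map (left_vertex r) [0..<r]))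
      (\<lambda>k (R', xs', ys'). k \<le> r * (42 * table_bound + 3) + 1 \<and> left_inv r R' xs' ys') (R1, stream 0, [])"
    by (rule wp_unroll[where I = left_inv]) (use left_vertex_spec init in auto)
  show ?thesis
    unfolding left_phase_def
    using regs by (simp add: R1_def[symmetric]) (rule wp_conseq[OF loop], auto)
qed

lemma count_edge_spec:
  assumes "R ONE = 1" "R ACC = int a" "30 \<le> a"
  shows "wp count_edge (\<lambda>k s. k \<le> 4 \<and>
    s = (R(BIT := R a, CNT := R CNT + R a, ACC := int (Suc a)), xs, ys)) (R, xs, ys)"
  using assms by (simp add: count_edge_def add.commute)

lemma count_row_spec:
  assumes j: "j < q" and "ctx R" "R ACC = int (30 + 2 * r + j * r)" "R CNT = 0"
  shows "wp (block (map (\<lambda>_. count_edge) [0..<r])) (\<lambda>k (R', xs', ys'). k \<le> r * 4 + 1 \<and>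
     (xs' = xs \<and> ys' = ys \<and> R' CNT = int (D (r + j)) \<and>
     (\<forall>c. c \<notin> {BIT, CNT, ACC} \<longrightarrow> R' c = R c))) (R, xs, ys)"
proof -
  define I where "I i R' xs' ys' \<longleftrightarrow> xs' = xs \<and> ys' = ys \<and>
     R' ACC = int (30 + 2 * r + (j * r + i)) \<and>
     R' CNT = int (deg (P \<inter> {..<j * r + i}) (r + j)) \<and>
     (\<forall>c. c \<notin> {BIT, CNT, ACC} \<longrightarrow> R' c = R c)" for i and R' :: "nat \<Rightarrow> int" and xs' ys'
  have "wp (block (map (\<lambda>_. count_edge) [0..<r])) (\<lambda>k (R', xs', ys'). k \<le> r * 4 + 1 \<and>
     I r R' xs' ys') (R, xs, ys)"
  proof (rule wp_unroll)
    show "I 0 R xs ys" using assms by (simp add: I_def deg_fresh[of "j * r"])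
    fix i R1 xs1 ys1 assume i: "i < r" and I: "I i R1 xs1 ys1"
    let ?p = "j * r + i"
    have pre: "R1 ONE = 1" "R1 ACC = int (30 + 2 * r + ?p)" "30 \<le> 30 + 2 * r + ?p"
      using I assms(2) by (auto simp: I_def ctx_def)
    have "R1 (30 + 2 * r + ?p) = of_bool (?p \<in> P)"
      using I assms(2) row_less[OF j i] by (simp add: I_def ctx_def)
    then show "wp count_edge (\<lambda>k (R', xs', ys'). k \<le> 4 \<and> I (Suc i) R' xs' ys') (R1, xs1, ys1)"
      using I i by (intro wp_mono[OF count_edge_spec[OF pre]])
        (auto simp: I_def deg_step lft_rgt_row)
  qed
  then show ?thesis
    by (rule wp_conseq) (auto simp: I_def deg_done)
qed

text \<open>
  The situation after \<open>i\<close> positions in the row of the right vertex \<open>r + j\<close>.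
\<close>

definition row_inv :: "nat \<Rightarrow> nat \<Rightarrow> nat \<Rightarrow> (nat \<Rightarrow> int) \<Rightarrow> int list \<Rightarrow> int list \<Rightarrow> bool" where
  "row_inv j tb i R xs ys \<longleftrightarrow> ctx R \<and> xs = stream (Suc (r + j)) \<and> ys = [] \<and> R TAB = int tb \<and>
     tab (Suc (r + j)) (j * r + i) tb R \<and> R LEN = int (sz r * Suc (D (r + j))) \<and>
     R OLEN = int (sz r) \<and> (\<forall>i'<r. R (30 + i') = int (wt i')) \<and>
     R EDGE = int (30 + 2 * r + (j * r + i)) \<and> R ROW = int (q - j)"

lemma relax_edge_run:
  assumes "R EDGE = int e" "30 \<le> e" "R ONE = 1"
    "wp relax G (R(BIT := R e, EDGE := int e + 1, SHIFT := 2 * R OLEN + R (30 + i)), xs, ys)"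
    "\<And>k s k'. G k s \<Longrightarrow> k' \<le> k + 5 \<Longrightarrow> H k' s"
  shows "wp (relax_edge i) H (R, xs, ys)"
  unfolding relax_edge_def using assms(1-3)
  by simp (rule wp_mono[OF assms(4)], simp, erule assms(5), simp)

lemma relax_edge_spec:
  assumes j: "j < q" and i: "i < r" and tb: "30 + 2 * r + q * r \<le> tb"
    and I: "row_inv j tb i R xs ys"
  shows "wp (relax_edge i) (\<lambda>k (R', xs', ys'). k \<le> 25 * table_bound + 5 \<and> row_inv j tb (Suc i) R' xs' ys')
    (R, xs, ys)"
proof -
  let ?p = "j * r + i"
  define \<delta> where "\<delta> = wt i + wt (r + j)"
  have wt: "wt (r + j) = 2 * sz r" using sz_const[of "r + j"] by (simp add: wt_def)
  have bit: "R (30 + 2 * r + ?p) = of_bool (?p \<in> P)"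
    using I row_less[OF j i] by (simp add: row_inv_def ctx_def)
  define R1 where "R1 = R(BIT := R (30 + 2 * r + ?p), EDGE := int (30 + 2 * r + ?p) + 1,
    SHIFT := 2 * R OLEN + R (30 + i))"
  have pre: "R1 ONE = 1" "R1 TAB = int tb" "R1 LEN = int (sz r * Suc (D (r + j)))" "R1 SHIFT = int \<delta>"
    "30 \<le> tb" "2 \<le> \<delta>"
    using I i tb wt sz_pos[of r] unfolding R1_def row_inv_def ctx_def \<delta>_def by auto
  have ctx1: "ctx R1"
    by (rule ctx_frame[where R = R]) (use I in \<open>auto simp: row_inv_def R1_def\<close>)
  have tab1: "tab (Suc (r + j)) ?p tb R1"
    by (rule tab_cong[where M = R]) (use I tb in \<open>auto simp: row_inv_def R1_def\<close>)
  show ?thesis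
  proof (rule relax_edge_run[where e = "30 + 2 * r + ?p" and
      G = "\<lambda>k (R', xs', ys'). k \<le> 25 * table_bound \<and> row_inv j tb (Suc i) R' xs' ys'"], goal_cases)
    case 4
    show ?case
      unfolding R1_def[symmetric]
    proof (rule wp_conseq[OF relax_spec[OF pre]], goal_cases)
      case (1 k R' xs' ys')
      then have R': "k \<le> sz r * Suc (D (r + j)) * 21 + 4" "xs' = xs" "ys' = ys"
        "\<And>y. y < sz r * Suc (D (r + j)) \<Longrightarrow> (R' (tb + 2 * y), R' (tb + 2 * y + 1)) =
          (let y' = tb + 2 * y + \<delta> in
           if 0 < R1 BIT \<and> R1 y' < R1 (tb + 2 * y) then (R1 y', 2 * R1 (y' + 1) + 1)
           else (R1 (tb + 2 * y), 2 * R1 (tb + 2 * y + 1)))"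
        "\<And>c. c < tb \<Longrightarrow> c \<notin> {SRC, DST, CTR, ACC, AUX} \<Longrightarrow> R' c = R1 c"
        by blast+
      have bit1: "0 < R1 BIT \<longleftrightarrow> ?p \<in> P" using bit by (simp add: R1_def)
      have "tab (Suc (r + j)) (Suc ?p) tb R'"
      proof (rule tab_relax[OF tab1], goal_cases)
        case 1
        show ?case using i by (simp add: lft_rgt_row)
      next
        case (2 y)
        then have "y < sz r * Suc (D (r + j))" unfolding wt by simp
        from R'(4)[OF this] show ?case
          using i unfolding bit1 \<delta>_def by (simp add: lft_rgt_row)
      qed
      moreover have "ctx R'" using ctx1 by (rule ctx_frame) (use R'(5) tb in auto)
      moreover have "R' (30 + i') = int (wt i')" if "i' < r" for i'
        using that I R'(5)[of "30 + i'"] tb unfolding row_inv_def R1_def by auto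
      moreover have "R' TAB = int tb" "R' LEN = int (sz r * Suc (D (r + j)))" "R' OLEN = int (sz r)"
        "R' EDGE = int (30 + 2 * r + (j * r + Suc i))" "R' ROW = int (q - j)"
        using R'(5) I tb by (auto simp: R1_def row_inv_def)
      moreover have "k \<le> 25 * table_bound" using R'(1) relax_budget[of r "r + j"] by linarith
      ultimately show ?case using R'(2,3) I unfolding row_inv_def by simp
    qed
  qed (use I in \<open>auto simp: row_inv_def ctx_def\<close>)
qed

text \<open>
  The situation after \<open>j\<close> rows.
\<close>

definition right_inv :: "nat \<Rightarrow> (nat \<Rightarrow> int) \<Rightarrow> int list \<Rightarrow> int list \<Rightarrow> bool" where
  "right_inv j R xs ys \<longleftrightarrow> ctx R \<and> xs = stream (r + j) \<and> ys = [] \<and> R LEN = int (sz r) \<and>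
     (\<forall>i'<r. R (30 + i') = int (wt i')) \<and> R EDGE = int (30 + 2 * r + j * r) \<and>
     (\<exists>tb. R TAB = int tb \<and> 30 + 2 * r + q * r \<le> tb \<and> tab (r + j) (j * r) tb R)"

lemma right_vertex_spec:
  assumes j: "j < q" and I: "right_inv j R xs ys" and ROW: "R ROW = int (q - j)"
  shows "wp (right_vertex r) (\<lambda>k (R', xs', ys'). k \<le> r * (25 * table_bound + 9) + 42 * table_bound + 20 \<and>
     right_inv (Suc j) R' xs' ys' \<and> R' ROW = int (q - Suc j)) (R, xs, ys)"
proof -
  obtain tb where tb: "R TAB = int tb" "30 + 2 * r + q * r \<le> tb" "tab (r + j) (j * r) tb R"
    using I by (auto simp: right_inv_def)
  define tb' where "tb' = tb + 2 * sz r"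
  have wt: "wt (r + j) = 2 * sz r" using sz_const[of "r + j"] by (simp add: wt_def)
  have szj: "sz (r + j) = sz r" using sz_const[of "r + j"] by simp
  have xs: "xs = map (f (r + j)) [0..<Suc (D (r + j))] @ stream (Suc (r + j))"
    using I j stream_step[of "r + j"] by (simp add: right_inv_def del: upt_Suc)
  define R1 where "R1 = R(CNT := 0, ACC := R EDGE)"
  have ctx1: "ctx R1"
    by (rule ctx_frame[where R = R]) (use I in \<open>auto simp: right_inv_def R1_def\<close>)
  have pre1: "R1 ACC = int (30 + 2 * r + j * r)" "R1 CNT = 0"
    using I by (auto simp: R1_def right_inv_def)
  show ?thesis
    unfolding right_vertex_def
  proof (simp add: R1_def[symmetric], rule wp_conseq[OF count_row_spec[OF j ctx1 pre1]], goal_cases)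
    case (1 k1 R2 xs2 ys2)
    define R3 where "R3 = R2(OLEN := R2 LEN)"
    have k1: "k1 \<le> r * 4 + 1" using 1 by blast
    have R3: "R3 c = R c" if "c \<notin> {CNT, ACC, BIT, OLEN}" for c
      using 1 that by (auto simp: R3_def R1_def)
    have pre3: "R3 ONE = 1" "R3 TAB = int tb" "R3 LEN = int (sz r)" "R3 CNT = int (D (r + j))"
      "30 \<le> tb" "R3 OLEN = int (sz r)"
      using 1 I tb R3 by (auto simp: R3_def right_inv_def ctx_def R1_def)
    have ctx3: "ctx R3"
      by (rule ctx_frame[where R = R]) (use I R3 in \<open>auto simp: right_inv_def\<close>)
    have tab3: "tab (r + j) (j * r) tb R3"
      by (rule tab_cong[where M = R]) (use tb R3 in \<open>auto simp: right_inv_def\<close>)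
    from 1 have "xs2 = xs" "ys2 = ys" by auto
    then show ?case
    proof (simp add: R3_def[symmetric],
        intro wp_conseq[OF extend_spec[OF pre3(1-5) xs]], goal_cases)
      case (1 k2 R4 xs4 ys4)
      then have R4: "k2 \<le> Suc (D (r + j)) * (12 * sz r + 10) + 20" "xs4 = stream (Suc (r + j))"
        "ys4 = ys" "R4 TAB = int tb'" "R4 LEN = int (sz r * Suc (D (r + j)))"
        "\<And>c y. c \<le> D (r + j) \<Longrightarrow> y < 2 * sz r \<Longrightarrow> R4 (tb' + c * (2 * sz r) + y) =
          R3 (tb + y) + (if even y then f (r + j) c else 0)"
        "\<And>c. c < tb' \<Longrightarrow> c \<notin> {CNT, TAB, LEN, NTAB, NLEN, SRC, DST, CTR, VAL, BIT} \<Longrightarrow>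
          R4 c = R3 c"
        unfolding tb'_def by blast+
      have tb': "30 + 2 * r + q * r \<le> tb'" using tb(2) by (simp add: tb'_def)
      have k2: "k2 \<le> 42 * table_bound" using R4(1) extend_budget[of "r + j" r] by linarith
      have "tab (Suc (r + j)) (j * r) tb' R4"
        using tab3 by (rule tab_extend) (use R4(6) in \<open>auto simp: wt\<close>)
      moreover have "ctx R4" using ctx3 by (rule ctx_frame) (use R4(7) tb' in auto)
      moreover have "R4 (30 + i') = int (wt i')" if "i' < r" for i'
        using that I R4(7)[of "30 + i'"] R3[of "30 + i'"] tb' unfolding right_inv_def by auto
      moreover have "R4 OLEN = int (sz r)" "R4 EDGE = int (30 + 2 * r + (j * r + 0))"
        "R4 ROW = int (q - j)"
        using R4(7) R3 pre3 I ROW tb' by (auto simp: right_inv_def)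
      ultimately have init: "row_inv j tb' 0 R4 xs4 ys4"
        using R4(2-5) I unfolding row_inv_def right_inv_def by simp
      have loop: "wp (block (map relax_edge [0..<r])) (\<lambda>k (R', xs', ys').
          k \<le> r * (25 * table_bound + 5) + 1 \<and> row_inv j tb' r R' xs' ys') (R4, xs4, ys4)"
        by (rule wp_unroll[where I = "row_inv j tb'"]) (use relax_edge_spec[OF j _ tb'] init in auto)
      show ?case
      proof (simp, rule wp_conseq[OF loop], goal_cases)
        case (1 k5 R5 xs5 ys5)
        define R6 where "R6 = R5(LEN := R5 OLEN, ROW := R5 ROW - R5 ONE)"
        have k5: "k5 \<le> r * (25 * table_bound + 5) + 1" and I5: "row_inv j tb' r R5 xs5 ys5" using 1 by auto
        have "ctx R6"
          by (rule ctx_frame[where R = R5]) (use I5 in \<open>auto simp: row_inv_def R6_def\<close>)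
        moreover have "tab (Suc (r + j)) (j * r + r) tb' R6"
          by (rule tab_cong[where M = R5]) (use I5 tb' in \<open>auto simp: row_inv_def R6_def\<close>)
        ultimately have "right_inv (Suc j) R6 xs5 ys5"
          using I5 tb' unfolding right_inv_def row_inv_def R6_def
          by (auto simp: add.commute)
        moreover have "R6 ROW = int (q - Suc j)"
          using I5 j unfolding row_inv_def ctx_def R6_def by auto
        moreover have "k1 + (k2 + k5) \<le> r * (25 * table_bound + 9) + 42 * table_bound + 2"
          using k1 k2 k5 by (simp add: algebra_simps)
        ultimately show ?case using I5 unfolding R6_def row_inv_def ctx_def by simp
      qed
    qed
  qed
qed

lemma right_phase_spec:
  assumes "left_inv r R xs ys"
  shows "wp (right_phase r) (\<lambda>k (R', xs', ys').
     k \<le> q * (r * (25 * table_bound + 9) + 42 * table_bound + 21) + 5 \<and> right_inv q R' xs' ys') (R, xs, ys)"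
proof -
  define R1 where "R1 = R(EDGE := 30 + 2 * int r, ROW := int q)"
  have "ctx R1" by (rule ctx_frame[where R = R]) (use assms in \<open>auto simp: left_inv_def R1_def\<close>)
  moreover obtain tb where tb: "R TAB = int tb" "30 + 2 * r + q * r \<le> tb" "tab r 0 tb R"
    using assms by (auto simp: left_inv_def)
  moreover have "tab r 0 tb R1"
    using tb(3) by (rule tab_cong) (use tb(2) in \<open>auto simp: R1_def\<close>)
  ultimately have init: "right_inv 0 R1 xs ys"
    using assms unfolding right_inv_def left_inv_def by (auto simp: R1_def)
  have loop: "wp (WhilePos ROW (right_vertex r)) (\<lambda>k (R', xs', ys').
      k \<le> q * Suc (r * (25 * table_bound + 9) + 42 * table_bound + 20) + 1 \<and> right_inv q R' xs' ys' \<and> R' ROW = 0)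
      (R1, xs, ys)"
    by (rule wp_count[where I = right_inv]) (use right_vertex_spec init in \<open>auto simp: R1_def\<close>)
  have "R ROWS = int q" using assms by (auto simp: left_inv_def ctx_def)
  then show ?thesis
    unfolding right_phase_def
    by (simp add: R1_def[symmetric]) (rule wp_conseq[OF loop], auto simp: algebra_simps)
qed

lemma code_split:
  assumes "finite S"
  shows "code m (S \<inter> {t..}) = of_bool (t \<in> S) * 2 ^ (m - Suc t) + code m (S \<inter> {Suc t..})"
proof (cases "t \<in> S")
  case True
  then have "S \<inter> {t..} = insert t (S \<inter> {Suc t..})" by (auto simp: Suc_le_eq le_less)
  with True assms show ?thesis by (simp add: code_def)
next
  case False
  then have "S \<inter> {t..} = S \<inter> {Suc t..}" by (auto simp: Suc_le_eq le_less)
  with False show ?thesis by simp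
qed

lemma code_less:
  assumes "S \<subseteq> {..<m}" "t \<le> m"
  shows "code m (S \<inter> {t..}) < 2 ^ (m - t)"
  using assms(2)
proof (induction rule: inc_induct)
  case base
  have "S \<inter> {m..} = {}" using assms(1) by auto
  then show ?case by (simp add: code_def)
next
  case (step t)
  have "finite S" using assms(1) finite_subset by auto
  have "(2::int) ^ (m - t) = 2 * 2 ^ (m - Suc t)"
    using step by (metis Suc_diff_Suc power_Suc)
  with step.IH have "code m (S \<inter> {Suc t..}) + 2 ^ (m - Suc t) < 2 ^ (m - t)" by simp
  moreover have "code m (S \<inter> {Suc t..}) < 2 ^ (m - t)"
    by (rule less_le_trans[OF step.IH]) (simp add: power_increasing)
  ultimately show ?case
    unfolding code_split[OF \<open>finite S\<close>, of m t] by (cases "t \<in> S") (auto simp: add.commute)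
qed

text \<open>
  After \<open>t\<close> digits of the code have been written, \<open>BIT\<close> holds the remaining ones, shifted to the
  left by \<open>t\<close> places.
\<close>

definition write_inv :: "nat set \<Rightarrow> nat \<Rightarrow> (nat \<Rightarrow> int) \<Rightarrow> int list \<Rightarrow> int list \<Rightarrow> bool" where
  "write_inv S t R xs ys \<longleftrightarrow> R ONE = 1 \<and> R ZERO = 0 \<and> R POW = 2 ^ (q * r) \<and>
     R BIT = 2 ^ t * code (q * r) (S \<inter> {t..}) \<and> ys = map (\<lambda>p. of_bool (p \<in> S)) [0..<t]"

text \<open>
  The digits behind position \<open>t\<close> contribute less than \<open>POW\<close> after the shift, so the comparison with
  \<open>POW\<close> decides whether \<open>t\<close> belongs to the set.
\<close>

lemma write_edge_spec:
  assumes S: "S \<subseteq> {..<q * r}" and t: "t < q * r" and I: "write_inv S t R xs ys"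
  shows "wp write_edge (\<lambda>k (R', xs', ys'). k \<le> 7 \<and> write_inv S (Suc t) R' xs' ys' \<and>
    R' ROW = R ROW) (R, xs, ys)"
proof -
  let ?m = "q * r" and ?rest = "code (q * r) (S \<inter> {Suc t..})"
  have "finite S" using S finite_subset by auto
  have "Suc t + (?m - Suc t) = ?m" using t by simp
  then have pow: "(2::int) ^ ?m = 2 ^ Suc t * 2 ^ (?m - Suc t)" by (metis power_add)
  have BIT: "2 * R BIT = of_bool (t \<in> S) * 2 ^ ?m + 2 ^ Suc t * ?rest"
    using I unfolding write_inv_def code_split[OF \<open>finite S\<close>, of ?m t] pow
    by (simp add: algebra_simps)
  have "?rest < 2 ^ (?m - Suc t)" using code_less[OF S, of "Suc t"] t by simp
  then have less: "2 ^ Suc t * ?rest < 2 ^ ?m" unfolding pow by simp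
  have "0 \<le> ?rest" by (simp add: code_def sum_nonneg)
  then have "0 \<le> 2 ^ Suc t * ?rest" by simp
  moreover have "R ONE = 1" "R ZERO = 0" "R POW = 2 ^ ?m"
    "ys = map (\<lambda>p. of_bool (p \<in> S)) [0..<t]" using I by (auto simp: write_inv_def)
  ultimately show ?thesis
    unfolding write_edge_def using less
    by (cases "t \<in> S") (simp_all add: BIT write_inv_def del: power_Suc)
qed

text \<open>
  Once all positions have been considered, only the offset \<open>0\<close> is admissible, and the first entry
  of the table is the optimum over all subgraphs.
\<close>

lemma write_phase_spec:
  assumes I: "right_inv q R xs ys"
  shows "wp (write_phase r) (\<lambda>k (R', xs', ys'). k \<le> q * (r * 7 + 4) + 6 \<and>
     (\<exists>S\<subseteq>P. (\<forall>S'\<subseteq>P. cost (r + q) (\<lambda>_. 0) S \<le> cost (r + q) (\<lambda>_. 0) S') \<and>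
       ys' = map (\<lambda>p. of_bool (p \<in> S)) [0..<q * r])) (R, xs, ys)"
proof -
  obtain tb where tb: "R TAB = int tb" "30 + 2 * r + q * r \<le> tb" "tab (r + q) (q * r) tb R"
    using I by (auto simp: right_inv_def)
  have P: "P \<inter> {..<q * r} = P" using P_bound by auto
  have "opt (q * r) (r + q) (\<lambda>_. 0) (R tb) (R (tb + 1))"
    using tb(3)[unfolded tab_def, THEN spec, of "\<lambda>_. 0"] by (simp add: P idx_def)
  then have "\<exists>S\<subseteq>P. R tb = cost (r + q) (\<lambda>_. 0) S \<and> R (tb + 1) = code (q * r) S \<and>
      (\<forall>S'\<subseteq>P. R tb \<le> cost (r + q) (\<lambda>_. 0) S')"
    unfolding opt_def P .
  then obtain S where S: "S \<subseteq> P" "R (tb + 1) = code (q * r) S"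
    "\<forall>S'\<subseteq>P. cost (r + q) (\<lambda>_. 0) S \<le> cost (r + q) (\<lambda>_. 0) S'"
    by (elim exE conjE) (rule that, auto)
  have S': "S \<subseteq> {..<q * r}" using S(1) P_bound by auto
  define R1 where "R1 = R(ACC := int tb + 1, BIT := R (Suc tb), ROW := int q)"
  have "ctx R" "ys = []" using I by (auto simp: right_inv_def)
  then have init: "write_inv S 0 R1 xs ys"
    using S(2) by (auto simp: write_inv_def R1_def ctx_def)
  have loop: "wp (WhilePos ROW (write_row r)) (\<lambda>k (R', xs', ys').
      k \<le> q * Suc (r * 7 + 3) + 1 \<and> write_inv S (q * r) R' xs' ys' \<and> R' ROW = 0) (R1, xs, ys)"
  proof (rule wp_count[where I = "\<lambda>j. write_inv S (j * r)"])
    fix j R2 xs2 ys2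
    assume j: "j < q" and I2: "write_inv S (j * r) R2 xs2 ys2" and ROW: "R2 ROW = int (q - j)"
    have *: "wp (block (map (\<lambda>_. write_edge) [0..<r])) (\<lambda>k (R', xs', ys'). k \<le> r * 7 + 1 \<and>
        (write_inv S (j * r + r) R' xs' ys' \<and> R' ROW = R2 ROW)) (R2, xs2, ys2)"
    proof (rule wp_unroll[where
          I = "\<lambda>i R' xs' ys'. write_inv S (j * r + i) R' xs' ys' \<and> R' ROW = R2 ROW"])
      fix i R3 xs3 ys3 assume "i < r" "write_inv S (j * r + i) R3 xs3 ys3 \<and> R3 ROW = R2 ROW"
      then show "wp write_edge (\<lambda>k (R', xs', ys'). k \<le> 7 \<and>
          (write_inv S (j * r + Suc i) R' xs' ys' \<and> R' ROW = R2 ROW)) (R3, xs3, ys3)"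
        using write_edge_spec[OF S' row_less[OF j], of i R3 xs3 ys3] by simp
    qed (use I2 in simp)
    show "wp (write_row r) (\<lambda>k (R', xs', ys'). k \<le> r * 7 + 3 \<and>
        write_inv S (Suc j * r) R' xs' ys' \<and> R' ROW = int (q - Suc j)) (R2, xs2, ys2)"
      unfolding write_row_def
    proof (simp, rule wp_conseq[OF *], goal_cases)
      case (1 k R' xs' ys')
      then show ?case using j ROW by (auto simp: write_inv_def add.commute)
    qed
  qed (use init in \<open>auto simp: R1_def\<close>)
  have "tb \<noteq> 15" using tb(2) by simp
  have regs: "R ONE = 1" "R ROWS = int q" using \<open>ctx R\<close> by (auto simp: ctx_def)
  show ?thesis
    unfolding write_phase_def
  proof (simp add: regs tb(1) \<open>tb \<noteq> 15\<close> R1_def[symmetric], rule wp_conseq[OF loop], goal_cases)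
    case (1 k R' xs' ys')
    then have "k \<le> q * (r * 7 + 4) + 1" "ys' = map (\<lambda>p. of_bool (p \<in> S)) [0..<q * r]"
      by (auto simp: write_inv_def algebra_simps)
    with S show ?case by auto
  qed
qed

text \<open>
  The four phases in sequence.  The right phase dominates: it runs \<open>q * r\<close> loops over a table.  The
  factor \<open>200\<close> generously covers the constants of all phases.
\<close>

lemma optimize_spec:
  "wp (optimize r) (\<lambda>k (R, xs, ys). k \<le> 200 * ((q + 1) * ((r + 1) * table_bound)) \<and>
     (\<exists>S\<subseteq>P. (\<forall>S'\<subseteq>P. cost (r + q) (\<lambda>_. 0) S \<le> cost (r + q) (\<lambda>_. 0) S') \<and>
       ys = map (\<lambda>p. of_bool (p \<in> S)) [0..<q * r]))
   (\<lambda>_. 0, int (r + q) # map (\<lambda>p. of_bool (p \<in> P)) [0..<q * r] @ stream 0, [])"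
  unfolding optimize_def
proof (simp only: block.simps wp_Seq, rule wp_conseq[OF read_phase_spec], goal_cases)
  case (1 k1 R1 xs1 ys1)
  then have 1: "k1 \<le> q * (r * 6 + 4) + 10" "ctx R1" "R1 EDGE = int (30 + 2 * r + q * r)"
    "xs1 = stream 0" "ys1 = []" by auto
  show ?case
    unfolding 1(4,5) wp_Seq
  proof (rule wp_conseq[OF left_phase_spec[OF 1(2,3)]], goal_cases)
    case (1 k2 R2 xs2 ys2)
    then have k2: "k2 \<le> r * (42 * table_bound + 3) + 10" and I2: "left_inv r R2 xs2 ys2" by auto
    show ?case
      unfolding wp_Seq
    proof (rule wp_conseq[OF right_phase_spec[OF I2]], goal_cases)
      case (1 k3 R3 xs3 ys3)
      then have k3: "k3 \<le> q * (r * (25 * table_bound + 9) + 42 * table_bound + 21) + 5"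
        and I3: "right_inv q R3 xs3 ys3" by auto
      show ?case
        unfolding wp_Seq
      proof (rule wp_conseq[OF write_phase_spec[OF I3]], goal_cases)
        case (1 k4 R4 xs4 ys4)
        then have k4: "k4 \<le> q * (r * 7 + 4) + 6" by auto
        have table_bound: "1 \<le> table_bound" unfolding table_bound_def by (rule one_le_power) simp
        have "k1 + (k2 + (k3 + (k4 + 1))) \<le> q * (r * 6 + 4) + 10 + (r * (42 * table_bound + 3) + 10 +
            (q * (r * (25 * table_bound + 9) + 42 * table_bound + 21) + 5 + (q * (r * 7 + 4) + 6 + 1)))"
          using \<open>k1 \<le> _\<close> k2 k3 k4 by linarith
        also have "\<dots> = (q * r) * 22 + q * 29 + r * 3 + 32 + table_bound * (r * 42 + q * r * 25 + q * 42)"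
          by (simp add: algebra_simps)
        also have "\<dots> \<le> table_bound * (q * r * 22 + q * 29 + r * 3 + 32)
            + table_bound * (r * 42 + q * r * 25 + q * 42)"
          using table_bound by simp
        also have "\<dots> = table_bound * (q * r * 47 + q * 71 + r * 45 + 32)" by (simp add: algebra_simps)
        also have "\<dots> \<le> table_bound * (200 * ((q + 1) * (r + 1)))"
          by (intro mult_le_mono2) (simp add: algebra_simps)
        finally have "k1 + (k2 + (k3 + (k4 + 1))) \<le> 200 * ((q + 1) * ((r + 1) * table_bound))"
          by (simp add: algebra_simps)
        with 1 show ?case by simp
      qed
    qed
  qed
qed

end

section \<open>Encodings and the polynomial bound\<close>

text \<open>
  The edge at position \<open>p\<close> of the matrix, in the original numbering of the vertices.
\<close>

definition edge :: "nat \<Rightarrow> nat \<Rightarrow> nat set" where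
  "edge r p = {Suc (p mod r), Suc (r + p div r)}"

lemma edge_inj:
  assumes "0 < r" "edge r p = edge r p'"
  shows "p = p'"
proof -
  have "p mod r < r" "p' mod r < r" using assms(1) by simp_all
  then have "p mod r = p' mod r \<and> p div r = p' div r"
    using assms(2) unfolding edge_def by (auto simp: doubleton_eq_iff)
  then show ?thesis by (metis div_mult_mod_eq)
qed

lemma complete_bipartite_eq_edges:
  assumes "0 < r"
  shows "complete_bipartite r (r + q) = edge r ` {..<q * r}"
proof (rule set_eqI, rule iffI)
  fix x assume "x \<in> complete_bipartite r (r + q)"
  then obtain i j where "x = {i, j}" "1 \<le> i" "i \<le> r" "r + 1 \<le> j" "j \<le> r + q"
    by (auto simp: complete_bipartite_def)
  then have ij: "x = {Suc (i - 1), Suc (r + (j - (r + 1)))}" "i - 1 < r" "j - (r + 1) < q"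
    by auto
  define a b where "a = i - 1" and "b = j - (r + 1)"
  have x: "x = {Suc a, Suc (r + b)}" "a < r" "b < q" using ij unfolding a_def b_def .
  then have "x = edge r (b * r + a)" by (simp add: edge_def)
  moreover have "b * r + a < q * r"
  proof -
    have "b * r + a < Suc b * r" using x by simp
    also have "\<dots> \<le> q * r" using x by (intro mult_le_mono1) simp
    finally show ?thesis .
  qed
  ultimately show "x \<in> edge r ` {..<q * r}" by blast
next
  fix x assume "x \<in> edge r ` {..<q * r}"
  then obtain p where p: "x = edge r p" "p < q * r" by auto
  have "p mod r < r" "p div r < q" using assms p(2) by (simp_all add: div_less_iff_less_mult)
  then show "x \<in> complete_bipartite r (r + q)"
    unfolding p(1) edge_def complete_bipartite_def mem_Collect_eq
    by (intro exI[of _ "Suc (p mod r)"] exI[of _ "Suc (r + p div r)"]) auto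
qed

lemma concat_rows: "concat (map (\<lambda>j. map (\<lambda>i. g (j * r + i)) [0..<r]) [0..<q]) = map g [0..<q * r]"
proof (induction q)
  case (Suc q)
  have "[0..<Suc q * r] = [0..<q * r] @ map (\<lambda>i. q * r + i) [0..<r]"
    using upt_add_eq_append[of 0 "q * r" r] map_add_upt[of "q * r" r] by (simp add: add.commute)
  with Suc show ?case by simp
qed simp

lemma encode_edges_eq:
  "encode_edges r (r + q) F = map (\<lambda>p. of_bool (edge r p \<in> F)) [0..<q * r]"
proof -
  have "[r + 1..<r + q + 1] = map (\<lambda>j. j + (r + 1)) [0..<q]" "[1..<r + 1] = map Suc [0..<r]"
    using map_add_upt[of "r + 1" q] by (simp_all add: map_Suc_upt add.commute)
  then have "encode_edges r (r + q) F =
    concat (map (\<lambda>j. map (\<lambda>i. of_bool ({Suc i, j + (r + 1)} \<in> F)) [0..<r]) [0..<q])"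
    by (simp add: encode_edges_def comp_def)
  also have "\<dots> = concat (map (\<lambda>j. map (\<lambda>i. of_bool (edge r (j * r + i) \<in> F)) [0..<r]) [0..<q])"
    by (intro arg_cong[where f = concat] map_cong) (auto simp: edge_def add.commute)
  finally show ?thesis using concat_rows[of "\<lambda>p. of_bool (edge r p \<in> F)"] by simp
qed

context degree_table
begin

lemma vdegree_edges: "vdegree (edge r ` S) (Suc u) = deg S u"
proof -
  have "{x \<in> edge r ` S. Suc u \<in> x} = edge r ` {p \<in> S. lft p = u \<or> rgt p = u}"
    by (auto simp: edge_def lft_def rgt_def)
  moreover have "inj_on (edge r) {p \<in> S. lft p = u \<or> rgt p = u}"
    using edge_inj[OF r_pos] by (auto intro: inj_onI)
  ultimately show ?thesis by (simp add: vdegree_def deg_def card_image)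
qed

end

lemma length_le_total_bit_size: "length xs \<le> total_bit_size xs"
  unfolding total_bit_size_def
proof (induction xs)
  case (Cons x xs)
  then show ?case using bit_size_pos[of x] by simp
qed simp

lemma bit_size_le_total: "x \<in> set xs \<Longrightarrow> bit_size x \<le> total_bit_size xs"
  unfolding total_bit_size_def by (intro member_le_sum_list) auto

text \<open>
  All registers are \<open>0\<close> at the start, so the largest initial number comes from the input.
\<close>

lemma computes_from_steps:
  assumes "steps c (\<lambda>_. 0, xs, []) k (R, xs', ys)"
  shows "\<exists>t. computes c xs t ys \<and> t \<le> 5 * k * (total_bit_size xs + prog_bits c + 1 + k)"
proof -
  have "fits (total_bit_size xs + prog_bits c + 1) (\<lambda>_. 0, xs, [])"
    using bit_size_le_total by (force simp: fits_def bit_size_def floorlog_def)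
  from steps_exec[OF assms this] show ?thesis unfolding computes_def by auto
qed

theorem theorem1p3:
  fixes r :: nat
  assumes "r \<ge> 1"
  shows "solvable_in_poly_time (degree_instances r) (encode_instance r)
           optimal_subgraphs (encode_subgraph r)"
proof -
  \<comment> \<open>\<open>T\<close> bounds the number of unit steps in terms of the input size, \<open>p\<close> the logarithmic cost.\<close>
  define T :: "nat poly" where "T = [:200 * (r + 1):] * [:1, 1:] ^ (r + 2)"
  define p :: "nat poly" where "p = [:5:] * T * ([:prog_bits (optimize r) + 1, 1:] + T)"
  have "\<exists>t. \<exists>y\<in>optimal_subgraphs x. computes (optimize r) (encode_instance r x) t
      (encode_subgraph r x y) \<and> t \<le> poly p (total_bit_size (encode_instance r x))"
    if "x \<in> degree_instances r" for x
  proof -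
    from that obtain n E f where x: "x = (n, E, f)" "r \<le> n" "E \<subseteq> complete_bipartite r n"
      unfolding degree_instances_def by auto
    define q where "q = n - r"
    have n: "n = r + q" using x(2) by (simp add: q_def)
    define P where "P = {p. p < q * r \<and> edge r p \<in> E}"
    interpret degree_table r q P "\<lambda>u. f (Suc u)"
      using assms by unfold_locales (auto simp: P_def)
    have E: "E = edge r ` P"
      using x(3) unfolding n complete_bipartite_eq_edges[OF r_pos] P_def by blast
    let ?N = "total_bit_size (encode_instance r x)"
    have range: "[1..<n + 1] = map Suc [0..<n]" by (simp add: map_Suc_upt)
    have "encode_functions n E f = stream 0"
      unfolding encode_functions_def stream_def n[symmetric] E range
      by (simp add: vdegree_edges comp_def del: upt_Suc)
    moreover have "encode_edges r n E = map (\<lambda>p. of_bool (p \<in> P)) [0..<q * r]"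
      unfolding n encode_edges_eq by (auto simp: P_def)
    ultimately have enc: "encode_instance r x =
        int (r + q) # map (\<lambda>p. of_bool (p \<in> P)) [0..<q * r] @ stream 0"
      by (simp add: encode_instance_def x(1) n)
    obtain k R xs' S where k: "steps (optimize r) (\<lambda>_. 0, encode_instance r x, []) k
          (R, xs', map (\<lambda>p. of_bool (p \<in> S)) [0..<q * r])"
        "k \<le> 200 * ((q + 1) * ((r + 1) * table_bound))"
      and S: "S \<subseteq> P" "\<And>S'. S' \<subseteq> P \<Longrightarrow> cost (r + q) (\<lambda>_. 0) S \<le> cost (r + q) (\<lambda>_. 0) S'"
      using optimize_spec unfolding wp_def enc[symmetric] by (auto split: prod.splits)
    have cost: "degree_cost n f (edge r ` S') = cost (r + q) (\<lambda>_. 0) S'" for S'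
      by (simp add: degree_cost_def cost_def n sum.atLeast1_atMost_eq vdegree_edges)
    have opt: "edge r ` S \<in> optimal_subgraphs x"
      unfolding optimal_subgraphs_def x(1) prod.case mem_Collect_eq
    proof (intro conjI allI impI)
      show "edge r ` S \<subseteq> E" using S(1) E by blast
      fix F' assume "F' \<subseteq> E"
      then obtain S' where "S' \<subseteq> P" "F' = edge r ` S'" unfolding E by (meson subset_imageE)
      then show "degree_cost n f (edge r ` S) \<le> degree_cost n f F'"
        unfolding cost using S(2) cost by simp
    qed
    have "edge r p \<in> edge r ` S \<longleftrightarrow> p \<in> S" for p using edge_inj[OF r_pos] by blast
    then have out: "encode_subgraph r x (edge r ` S) = map (\<lambda>p. of_bool (p \<in> S)) [0..<q * r]"
      by (simp add: encode_subgraph_def x(1) n encode_edges_eq)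
    obtain t where t: "computes (optimize r) (encode_instance r x) t (encode_subgraph r x (edge r ` S))"
        "t \<le> 5 * k * (?N + prog_bits (optimize r) + 1 + k)"
      using computes_from_steps[OF k(1)] out by auto
    \<comment> \<open>Every matrix entry takes at least one bit, so \<open>q\<close> is at most the input size even though
      \<open>n\<close> itself is given in binary.\<close>
    have "q * r + 1 \<le> ?N"
      using length_le_total_bit_size[of "encode_instance r x"] by (simp add: enc)
    moreover have "q \<le> q * r" using r_pos by simp
    ultimately have "q + 1 \<le> ?N + 1" "q * r + 1 \<le> ?N + 1" by linarith+
    then have "(q + 1) * table_bound \<le> (?N + 1) * (?N + 1) ^ (r + 1)"
      unfolding table_bound_def by (intro mult_mono power_mono) auto
    then have bound: "200 * (r + 1) * ((q + 1) * table_bound) \<le> 200 * (r + 1) * (?N + 1) ^ (r + 2)"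
      by (intro mult_le_mono2) simp
    have "k \<le> 200 * (r + 1) * ((q + 1) * table_bound)" using k(2) by (simp only: ac_simps)
    also note bound
    also have "200 * (r + 1) * (?N + 1) ^ (r + 2) = poly T ?N" by (simp add: T_def)
    finally have "k \<le> poly T ?N" .
    then have "t \<le> 5 * poly T ?N * (?N + prog_bits (optimize r) + 1 + poly T ?N)"
      by (intro order_trans[OF t(2)] mult_mono add_mono) auto
    also have "\<dots> = poly p ?N"
      by (simp add: p_def algebra_simps)
    finally show ?thesis using t(1) opt by blast
  qed
  then show ?thesis unfolding solvable_in_poly_time_def by blast
qed

end
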